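(* Let $\mathcal{A}$ be a $C^{\ast}$-algebra, let $\mathcal{B}$ be a Banach algebra, let $\mathcal{M}$ be a Banach $\mathcal{B}$-bimodule and let $D_1: \mathcal{A} \rightarrow \mathcal{M}$ be an $(E, F, G, H)$-derivation such that $E, H: \mathcal{A} \rightarrow \mathcal{M}$ are linear and $F, G:\mathcal{A} \rightarrow \mathcal{B}$ are mappings which are continuous at zero. Moreover, assume that either $(G(ab) - G(a)G(b))H(c) = 0$ for all $a, b, c \in \mathcal{A}$, or $E(c) (F(ab) - F(a)F(b)) = 0$ for all $a, b, c \in \mathcal{A}$. Then $D_1$ is continuous.
   Context: Let $\mathcal{A}$ and $\mathcal{B}$ be algebras and let $\mathcal{M}$ be a $\mathcal{B}$-bimodule. Given mappings (not assumed linear unless stated) $E, H:\mathcal{A} \rightarrow \mathcal{M}$ and $F, G:\mathcal{A} \rightarrow \mathcal{B}$, an $(E,F,G,H)$-derivation (also called a strongly generalized derivation of order one) is a linear mapping $D_1:\mathcal{A} \rightarrow \mathcal{M}$ such that $D_1(ab) = E(a)F(b) + G(a)H(b)$ for all $a, b \in \mathcal{A}$, where the products on the right are the right and left module actions of $\mathcal{B}$ on $\mathcal{M}$. Algebras are not assumed to be unital. A Banach $\mathcal{B}$-bimodule is a Banach space that is a $\mathcal{B}$-bimodule with bounded (jointly continuous) bilinear left and right module actions. *)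

theory Defs
  imports "HOL-Analysis.Analysis"
begin

text \<open>
  The distribution only has real normed spaces, so the complex ones are built here on top of the
  real classes, with the real scalar multiplication being the restriction of the complex one.
  None of the algebras below is assumed to be unital.
\<close>

class complex_vector = real_vector +
  fixes scaleC :: "complex \<Rightarrow> 'a \<Rightarrow> 'a" (infixr "*\<^sub>C" 75)
  assumes scaleR_eq_scaleC: "r *\<^sub>R x = complex_of_real r *\<^sub>C x"
    and scaleC_add_right: "c *\<^sub>C (x + y) = c *\<^sub>C x + c *\<^sub>C y"
    and scaleC_add_left: "(c + d) *\<^sub>C x = c *\<^sub>C x + d *\<^sub>C x"
    and scaleC_scaleC: "c *\<^sub>C d *\<^sub>C x = (c * d) *\<^sub>C x"
    and scaleC_one: "1 *\<^sub>C x = x"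

lemma vector_space_scaleC:
  "vector_space (scaleC :: complex \<Rightarrow> 'a \<Rightarrow> 'a :: complex_vector)"
  by unfold_locales (simp_all add: scaleC_add_right scaleC_add_left scaleC_scaleC scaleC_one)

abbreviation clinear :: "('a :: complex_vector \<Rightarrow> 'b :: complex_vector) \<Rightarrow> bool" where
  "clinear \<equiv> Vector_Spaces.linear scaleC scaleC"

class complex_algebra = complex_vector + real_algebra +
  assumes mult_scaleC_left: "(c *\<^sub>C x) * y = c *\<^sub>C (x * y)"
    and mult_scaleC_right: "x * (c *\<^sub>C y) = c *\<^sub>C (x * y)"

class complex_normed_vector = complex_vector + real_normed_vector +
  assumes norm_scaleC: "norm (c *\<^sub>C x) = cmod c * norm x"

class complex_banach = complex_normed_vector + banach

class complex_banach_algebra = complex_algebra + complex_banach + real_normed_algebra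

class cstar_algebra = complex_banach_algebra +
  fixes adj :: "'a \<Rightarrow> 'a"
  assumes adj_adj: "adj (adj x) = x"
    and adj_add: "adj (x + y) = adj x + adj y"
    and adj_scaleC: "adj (c *\<^sub>C x) = cnj c *\<^sub>C adj x"
    and adj_mult: "adj (x * y) = adj y * adj x"
    and cstar_identity: "norm (adj x * x) = (norm x)\<^sup>2"

text \<open>
  In the following locale, \<^const>\<open>bounded_bilinear\<close> provides additivity in each argument, real
  homogeneity and joint boundedness; complex homogeneity has to be added.
\<close>

locale banach_bimodule =
  fixes lact :: "'b :: complex_banach_algebra \<Rightarrow> 'm :: complex_banach \<Rightarrow> 'm" (infixr "\<rhd>" 72)
    and ract :: "'m \<Rightarrow> 'b \<Rightarrow> 'm" (infixl "\<lhd>" 72)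
  assumes bounded_bilinear_lact: "bounded_bilinear (\<rhd>)"
    and bounded_bilinear_ract: "bounded_bilinear (\<lhd>)"
    and lact_scaleC_left: "(c *\<^sub>C b) \<rhd> x = c *\<^sub>C (b \<rhd> x)"
    and lact_scaleC_right: "b \<rhd> (c *\<^sub>C x) = c *\<^sub>C (b \<rhd> x)"
    and ract_scaleC_left: "(c *\<^sub>C x) \<lhd> b = c *\<^sub>C (x \<lhd> b)"
    and ract_scaleC_right: "x \<lhd> (c *\<^sub>C b) = c *\<^sub>C (x \<lhd> b)"
    and lact_mult: "(a * b) \<rhd> x = a \<rhd> (b \<rhd> x)"
    and ract_mult: "x \<lhd> (a * b) = (x \<lhd> a) \<lhd> b"
    and lact_ract: "(a \<rhd> x) \<lhd> b = a \<rhd> (x \<lhd> b)"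

definition EFGH_derivation ::
    "('b \<Rightarrow> 'm \<Rightarrow> 'm) \<Rightarrow> ('m \<Rightarrow> 'b \<Rightarrow> 'm) \<Rightarrow>
     ('a :: complex_algebra \<Rightarrow> 'm) \<Rightarrow> ('a \<Rightarrow> 'b) \<Rightarrow> ('a \<Rightarrow> 'b) \<Rightarrow> ('a \<Rightarrow> 'm) \<Rightarrow>
     ('a \<Rightarrow> 'm :: complex_vector) \<Rightarrow> bool" where
  "EFGH_derivation lact ract E F G H D \<longleftrightarrow>
     clinear D \<and> (\<forall>a b. D (a * b) = ract (E a) (F b) + lact (G a) (H b))"

end

theory Submission
  imports Defs
begin

text \<open>
  Write $D(ab) = C(a,b) + B(a,b)$ with $C(a,b) = E(a)F(b)$ and $B(a,b) = G(a)H(b)$. As $D$, $E$ and $H$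
  are linear, $B$ and $C$ are bilinear, although $F$ and $G$ need not be additive; by the
  continuity of $F$ and $G$ at zero, $C$ is continuous in its second and $B$ in its first argument.
  Let $J$ be the set of all $a$ for which $x \mapsto D(ax)$ is bounded, equivalently for which
  $B(a,\cdot)$ is bounded. It is a right ideal because $D(abx) = D(a(bx))$, it is closed by uniform
  boundedness, and under the first alternative of the hypothesis it is a left ideal, because then
  $B(ba,x) = G(b)B(a,x)$. Applying the involution to everything, that is replacing $D$ by
  $x \mapsto D(x^*)$, exchanges the two alternatives, so only the first needs an argument. This
  symmetry is antilinear, and therefore the general result (\<open>separated_product\<close>) concerns
  real linear maps.

  The claim becomes $J = A$. Three facts about the closed ideal $J$ give it.

  \<^item> $D$ is bounded on $J$. A null sequence in $J$ that tends to zero fast enough has the form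
    $u_n = b c_n$ with $b \in J$ and $c_n \to 0$ (\<open>null_sequence_factorization\<close>, after Cohen),
    and $x \mapsto D(bx)$ is bounded.
  \<^item> There are no $s_n, r_n$ with $s_n r_n \notin J$ and $s_n r_m \in J$ for $m > n$
    (\<open>gliding_hump\<close>): otherwise one element $w = \sum_n r_n t_n$ would make $D(s_n w)$
    large compared with the bound that the continuity of $C(s_n,\cdot)$ and $B(\cdot,w)$ gives.
    This entails both the ascending and the descending chain condition for left annihilators
    modulo $J$.
  \<^item> By the chain conditions $A/J$ behaves like a finite-dimensional C*-algebra. An element whose
    annihilator is maximal yields a minimal projection $p$ modulo $J$ (\<open>atom_below\<close>); between two such
    projections $pAq$ is one-dimensional modulo $J$; and a sum of finitely many orthogonal ones is a
    unit modulo $J$. So if $q$ is a minimal projection modulo $J$, then $x \mapsto D(qx)$ is a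
    finite sum of bounded maps up to $D|_J$ (\<open>atom_left_bounded\<close>), which puts $q$ into $J$. Hence
    there are no minimal projections modulo $J$, and $J = A$.

  Both the approximate units behind the factorization and the minimal projections need a little
  functional calculus for self-adjoint elements. Square roots suffice, and they come from one
  iteration: $s \mapsto (y + s^2)/2$ converges to $1 - \sqrt{1-y}$ for every contraction $y$. If $T$ is
  self-adjoint with $\|T\| \le 1$, then $R = \sqrt{1 - T^2}$ exists and $T \pm iR$ are
  isometries, so $\|1 - T^2\| = \|R^2\| \le 1$ (\<open>norm_id_minus_square_le\<close>). This inequality replaces the reality of
  the spectrum; it allows to form $|T| = \sqrt{1 - (1 - T^2)}$. Since the algebra may lack a unit, all this
  takes place among the self-adjoint multipliers, operators on the algebra that include the identity.
\<close>

section \<open>Sequences and families of operators in Banach spaces\<close>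

text \<open>
  The majorant \<open>\<sigma>\<close> telescopes, so the error is bounded explicitly and not only qualitatively. The
  uniformity of the bound is what makes square roots depend continuously on the operator.
\<close>

lemma majorized_sequence_converges:
  fixes x :: "nat \<Rightarrow> 'a::banach" and \<sigma> :: "nat \<Rightarrow> real"
  assumes step: "\<And>n. norm (x (Suc n) - x n) \<le> \<sigma> (Suc n) - \<sigma> n"
    and lim: "\<sigma> \<longlonglongrightarrow> s"
  obtains L where "x \<longlonglongrightarrow> L" "\<And>n. norm (L - x n) \<le> s - \<sigma> n"
proof -
  have diff: "norm (x (n + k) - x n) \<le> \<sigma> (n + k) - \<sigma> n" for n k
  proof (induction k)
    case (Suc k)
    have "norm (x (n + Suc k) - x n) \<le> norm (x (Suc (n + k)) - x (n + k)) + norm (x (n + k) - x n)"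
      using norm_triangle_ineq[of "x (Suc (n + k)) - x (n + k)" "x (n + k) - x n"] by simp
    then show ?case using step[of "n + k"] Suc.IH by simp
  qed simp
  have "Cauchy x"
  proof (rule metric_CauchyI)
    fix e :: real assume "e > 0"
    then obtain N where N: "\<And>m n. m \<ge> N \<Longrightarrow> n \<ge> N \<Longrightarrow> dist (\<sigma> m) (\<sigma> n) < e"
      using LIMSEQ_imp_Cauchy[OF lim] unfolding Cauchy_def by blast
    have le: "dist (x m) (x n) < e" if "N \<le> n" "n \<le> m" for m n
      using diff[of n "m - n"] N[of m n] that by (auto simp: dist_norm abs_less_iff)
    show "\<exists>M. \<forall>m\<ge>M. \<forall>n\<ge>M. dist (x m) (x n) < e"
    proof (intro exI allI impI)
      fix m n assume "N \<le> m" "N \<le> n"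
      then show "dist (x m) (x n) < e"
        using le[of n m] le[of m n] by (cases "n \<le> m") (auto simp: dist_commute)
    qed
  qed
  then obtain L where L: "x \<longlonglongrightarrow> L" using Cauchy_convergent convergent_def by blast
  have "norm (L - x n) \<le> s - \<sigma> n" for n
  proof (rule tendsto_le[OF sequentially_bot])
    show "(\<lambda>k. \<sigma> (k + n) - \<sigma> n) \<longlonglongrightarrow> s - \<sigma> n"
      by (intro tendsto_intros LIMSEQ_ignore_initial_segment lim)
    show "(\<lambda>k. norm (x (k + n) - x n)) \<longlonglongrightarrow> norm (L - x n)"
      by (intro tendsto_intros LIMSEQ_ignore_initial_segment L)
    show "\<forall>\<^sub>F k in sequentially. norm (x (k + n) - x n) \<le> \<sigma> (k + n) - \<sigma> n"
      using diff[of n] by (simp add: add.commute)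
  qed
  with L that show ?thesis by blast
qed

lemma geometric_steps_converge:
  fixes x :: "nat \<Rightarrow> 'a::banach"
  assumes step: "\<And>n. norm (x (Suc n) - x n) \<le> c * q ^ n" and q: "0 \<le> q" "q < 1"
  obtains L where "x \<longlonglongrightarrow> L" "\<And>n. norm (L - x n) \<le> c * q ^ n / (1 - q)"
proof -
  define \<sigma> where "\<sigma> n = - (c * q ^ n / (1 - q))" for n
  have "c * q ^ n = \<sigma> (Suc n) - \<sigma> n" for n
    using q by (simp add: \<sigma>_def divide_simps) (simp add: algebra_simps)
  moreover have "\<sigma> \<longlonglongrightarrow> - (c * 0 / (1 - q))"
    unfolding \<sigma>_def using q by (intro tendsto_intros LIMSEQ_power_zero) auto
  ultimately show ?thesis
    using majorized_sequence_converges[of x \<sigma> 0] step that by (auto simp: \<sigma>_def)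
qed

text \<open>
  For a displacement $v$ the values at $x + v$ and $x - v$ differ by $2Tv$, so one of them is at
  least as large as $Tv$, wherever the centre $x$ lies.
\<close>

lemma blinfun_large_value_near:
  fixes T :: "'a::real_normed_vector \<Rightarrow>\<^sub>L 'b::real_normed_vector"
  assumes "r > 0"
  obtains y where "norm (y - x) \<le> r" "norm (T y) \<ge> 2/3 * r * norm T"
proof -
  obtain v where v: "norm v \<le> r" "norm (T v) \<ge> 2/3 * r * norm T"
  proof (cases "norm T = 0")
    case True
    then show ?thesis using that[of 0] assms by simp
  next
    case False
    have "\<exists>u. norm (T u) > 2/3 * norm T * norm u"
    proof (rule ccontr)
      assume "\<not> ?thesis"
      then have "norm T \<le> 2/3 * norm T"
        by (intro norm_blinfun_bound) (auto simp: not_less)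
      with False show False by auto
    qed
    then obtain u where u: "norm (T u) > 2/3 * norm T * norm u" by blast
    then have "u \<noteq> 0" by auto
    then have "norm (T ((r / norm u) *\<^sub>R u)) = r / norm u * norm (T u)"
      using assms by (simp add: blinfun.scaleR_right)
    also have "\<dots> \<ge> r / norm u * (2/3 * norm T * norm u)"
      using u assms \<open>u \<noteq> 0\<close> by (intro mult_left_mono) auto
    finally show ?thesis using that[of "(r / norm u) *\<^sub>R u"] assms \<open>u \<noteq> 0\<close> by (simp add: field_simps)
  qed
  have "2 * norm (T v) = norm (T (x + v) - T (x - v))"
    by (simp add: blinfun.bilinear_simps flip: scaleR_2)
  also have "\<dots> \<le> norm (T (x + v)) + norm (T (x - v))" by (rule norm_triangle_ineq4)
  finally have "norm (T v) \<le> norm (T (x + v)) \<or> norm (T v) \<le> norm (T (x - v))" by linarith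
  then show ?thesis using that[of "x + v"] that[of "x - v"] v by auto
qed

text \<open>
  An elementary gliding hump proof. If some $T_n$ have norm above $4^n$, steps of length $3^{-n}$ can
  keep $T_n$ at two thirds of its largest possible size; all later steps together have length at
  most $3^{-n}/2$, hence cannot spoil this, and $T_n$ exceeds $(4/3)^n/6$ at the limit point.
\<close>

lemma uniform_boundedness:
  fixes T :: "'i \<Rightarrow> 'a::banach \<Rightarrow>\<^sub>L 'b::real_normed_vector"
  assumes pointwise: "\<And>x. \<exists>M. \<forall>i. norm (T i x) \<le> M"
  obtains K where "\<And>i. norm (T i) \<le> K"
proof (rule ccontr)
  assume "\<not> thesis"
  then have "\<exists>i. norm (T i) > K" for K using that by (meson not_le)
  then have "\<exists>i. \<forall>n. norm (T (i n)) > 4 ^ n" by (intro choice) auto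
  then obtain i where i: "\<And>n. norm (T (i n)) > 4 ^ n" by blast
  have "\<exists>y. norm (y - x) \<le> (1/3) ^ Suc n \<and>
      2/3 * (1/3) ^ Suc n * norm (T (i (Suc n))) \<le> norm (T (i (Suc n)) y)" for x n
    using blinfun_large_value_near[of "(1/3) ^ Suc n" x "T (i (Suc n))"] by fastforce
  then have "\<exists>x. \<forall>n. True \<and> (norm (x (Suc n) - x n) \<le> (1/3) ^ Suc n \<and>
      2/3 * (1/3) ^ Suc n * norm (T (i (Suc n))) \<le> norm (T (i (Suc n)) (x (Suc n))))"
    by (intro dependent_nat_choice) auto
  then obtain x where x: "\<And>n. norm (x (Suc n) - x n) \<le> 1/3 * (1/3) ^ n"
    and Tx: "\<And>n. norm (T (i (Suc n)) (x (Suc n))) \<ge> 2/3 * (1/3) ^ Suc n * norm (T (i (Suc n)))"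
    by auto
  obtain L where L: "\<And>n. norm (L - x n) \<le> 1/3 * (1/3) ^ n / (1 - 1/3)"
    using geometric_steps_converge[OF x] by auto
  obtain M where M: "\<And>j. norm (T j L) \<le> M" using pointwise by blast
  have "1/6 * (4/3) ^ Suc n \<le> M" for n
  proof -
    let ?T = "T (i (Suc n))"
    have "norm (?T (x (Suc n))) \<le> norm (?T L) + norm (?T (L - x (Suc n)))"
      using norm_triangle_ineq4[of "?T L" "?T (L - x (Suc n))"] by (simp add: blinfun.bilinear_simps)
    also have "norm (?T (L - x (Suc n))) \<le> norm ?T * norm (L - x (Suc n))" by (rule norm_blinfun)
    also have "\<dots> \<le> norm ?T * (1/2 * (1/3) ^ Suc n)"
      using L[of "Suc n"] by (intro mult_left_mono) auto
    finally have "1/6 * (1/3) ^ Suc n * norm ?T \<le> M"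
      using Tx[of n] M[of "i (Suc n)"] by (simp add: algebra_simps)
    moreover have "1/6 * (1/3) ^ Suc n * norm ?T \<ge> 1/6 * (1/3) ^ Suc n * 4 ^ Suc n"
      using i[of "Suc n"] by (intro mult_left_mono) auto
    ultimately show ?thesis by (simp add: power_divide)
  qed
  moreover obtain n where "6 * \<bar>M\<bar> < (4/3::real) ^ n" using real_arch_pow[of "4/3::real"] by auto
  then have "M < 1/6 * (4/3) ^ Suc n"
    using power_increasing[of n "Suc n" "4/3::real"] by simp
  ultimately show False by (meson not_le)
qed

text \<open>
  Continuity at zero is the form in which the hypotheses on $F$ and $G$ enter.
\<close>

lemma linear_isCont_zero_bounded:
  fixes f :: "'a::real_normed_vector \<Rightarrow> 'b::real_normed_vector"
  assumes "linear f" "isCont f 0"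
  shows "bounded_linear f"
proof -
  interpret linear f by fact
  obtain d where d: "d > 0" "\<And>x. norm x < d \<Longrightarrow> norm (f x) < 1"
    using assms(2) unfolding continuous_at_eps_delta dist_norm by (metis diff_zero zero less_numeral_extra(1))
  have "norm (f x) \<le> norm x * (2 / d)" for x
  proof (cases "x = 0")
    case False
    have "norm (f ((d / (2 * norm x)) *\<^sub>R x)) < 1" using d False by (intro d(2)) auto
    then show ?thesis using d False by (simp add: scale field_simps)
  qed (simp add: zero)
  then show ?thesis by (intro bounded_linear_intro[of _ "2/d"]) (auto simp: add scale)
qed

section \<open>The involution of a C*-algebra\<close>

lemma scaleC_minus_one: "(- 1) *\<^sub>C x = - (x :: 'a::complex_vector)"
  using scaleR_eq_scaleC[of "-1" x] by simp

lemma scaleC_zero_right [simp]: "c *\<^sub>C 0 = (0 :: 'a::complex_vector)"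
  using scaleC_add_right[of c 0 "0::'a"] by simp

lemma scaleC_minus_right: "c *\<^sub>C (- x) = - (c *\<^sub>C (x :: 'a::complex_vector))"
  using scaleC_add_right[of c x "-x"] by (simp add: eq_neg_iff_add_eq_0 add.commute)

lemma scaleC_diff_right: "c *\<^sub>C (x - y) = c *\<^sub>C x - c *\<^sub>C (y :: 'a::complex_vector)"
  using scaleC_add_right[of c x "-y"] by (simp add: scaleC_minus_right)

lemma scaleC_i_i: "\<i> *\<^sub>C \<i> *\<^sub>C x = - (x :: 'a::complex_vector)"
  by (simp add: scaleC_scaleC scaleC_minus_one)

lemma adj_scaleR: "adj (r *\<^sub>R x) = r *\<^sub>R adj (x :: 'a::cstar_algebra)"
  by (simp add: scaleR_eq_scaleC adj_scaleC)

lemma adj_zero [simp]: "adj 0 = (0 :: 'a::cstar_algebra)"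
  using adj_scaleR[of 0 0] by simp

lemma adj_minus: "adj (- x) = - adj (x :: 'a::cstar_algebra)"
  using adj_scaleR[of "-1" x] by simp

lemma adj_diff: "adj (x - y) = adj x - adj (y :: 'a::cstar_algebra)"
  using adj_add[of x "-y"] by (simp add: adj_minus)

lemma norm_adj [simp]: "norm (adj x) = norm (x :: 'a::cstar_algebra)"
proof -
  have le: "norm y \<le> norm (adj y)" for y :: 'a
  proof (cases "y = 0")
    case False
    have "norm y * norm y \<le> norm (adj y) * norm y"
      using cstar_identity[of y] norm_mult_ineq[of "adj y" y] by (simp add: power2_eq_square)
    with False show ?thesis by simp
  qed simp
  show ?thesis using le[of x] le[of "adj x"] by (simp add: adj_adj)
qed

lemma cstar_identity_right: "norm (x * adj x) = (norm (x :: 'a::cstar_algebra))\<^sup>2"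
  using cstar_identity[of "adj x"] by (simp add: adj_adj)

lemma bounded_linear_adj: "bounded_linear (adj :: 'a::cstar_algebra \<Rightarrow> 'a)"
  by (intro bounded_linear_intro[of _ 1]) (auto simp: adj_add adj_scaleR)

section \<open>Square roots of operators\<close>

text \<open>
  The fixed points $s$ of $s \mapsto (y + s^2)/2$ are the solutions of $(1-s)^2 = 1-y$. Iteration from $0$
  produces polynomials in $y$ with nonnegative coefficients, so the scalar iteration at $y = 1$, which
  increases to $1$, dominates it for every contraction $y$.
\<close>

primrec sqrt_step :: "('a::real_normed_vector \<Rightarrow>\<^sub>L 'a) \<Rightarrow> nat \<Rightarrow> 'a \<Rightarrow>\<^sub>L 'a" where
  "sqrt_step y 0 = 0"
| "sqrt_step y (Suc n) = (1/2) *\<^sub>R (y + (sqrt_step y n o\<^sub>L sqrt_step y n))"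

primrec sqrt_majorant :: "nat \<Rightarrow> real" where
  "sqrt_majorant 0 = 0"
| "sqrt_majorant (Suc n) = (1 + sqrt_majorant n * sqrt_majorant n) / 2"

lemma sqrt_majorant_bounds: "0 \<le> sqrt_majorant n \<and> sqrt_majorant n \<le> 1"
proof (induction n)
  case (Suc n)
  then show ?case using mult_le_one[of "sqrt_majorant n" "sqrt_majorant n"] by simp
qed simp

lemma sqrt_majorant_tendsto: "sqrt_majorant \<longlonglongrightarrow> 1"
proof -
  have "sqrt_majorant n \<le> sqrt_majorant (Suc n)" for n
    using zero_le_square[of "1 - sqrt_majorant n"] by (simp add: algebra_simps)
  then have "incseq sqrt_majorant" by (rule incseq_SucI)
  then obtain s where s: "sqrt_majorant \<longlonglongrightarrow> s"
    using sqrt_majorant_bounds by (meson incseq_convergent)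
  have "(\<lambda>n. sqrt_majorant (Suc n)) \<longlonglongrightarrow> (1 + s * s) / 2"
    unfolding sqrt_majorant.simps by (intro tendsto_intros s) auto
  moreover have "(\<lambda>n. sqrt_majorant (Suc n)) \<longlonglongrightarrow> s" using s by (rule LIMSEQ_Suc)
  ultimately have "s = (1 + s * s) / 2" using LIMSEQ_unique by blast
  then have "(s - 1) * (s - 1) = 0" by (simp add: algebra_simps)
  with s show ?thesis by simp
qed

lemma norm_sqrt_step_le:
  assumes "norm y \<le> 1"
  shows "norm (sqrt_step y n) \<le> sqrt_majorant n"
proof (induction n)
  case (Suc n)
  have "norm (y + (sqrt_step y n o\<^sub>L sqrt_step y n)) \<le> norm y + norm (sqrt_step y n o\<^sub>L sqrt_step y n)"
    by (rule norm_triangle_ineq)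
  also have "norm (sqrt_step y n o\<^sub>L sqrt_step y n) \<le> norm (sqrt_step y n) * norm (sqrt_step y n)"
    by (rule norm_blinfun_compose)
  also have "\<dots> \<le> sqrt_majorant n * sqrt_majorant n"
    using Suc.IH sqrt_majorant_bounds by (intro mult_mono) auto
  finally show ?case using assms by simp
qed simp

lemma norm_sqrt_step_diff_le:
  assumes "norm y \<le> 1"
  shows "norm (sqrt_step y (Suc n) - sqrt_step y n) \<le> sqrt_majorant (Suc n) - sqrt_majorant n"
proof (induction n)
  case 0
  then show ?case using assms by simp
next
  case (Suc n)
  let ?s = "sqrt_step y" and ?m = "sqrt_majorant"
  let ?d = "?s (Suc n) - ?s n"
  \<comment> \<open>Rewriting with the recursion equation would unfold every term of the iteration.\<close>
  have halves: "A - B = (1/2) *\<^sub>R (P - Q)"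
    if "A = (1/2) *\<^sub>R (y + P)" "B = (1/2) *\<^sub>R (y + Q)" for A B P Q
    unfolding that by (simp add: algebra_simps)
  have difference: "1/2 * ((a - b) * a + b * (a - b)) = c - a"
    if "c = (1 + a * a) / 2" "a = (1 + b * b) / 2" for a b c :: real
  proof -
    have "b * b = 2 * a - 1" using that(2) by simp
    then show ?thesis unfolding that(1) by (simp add: algebra_simps)
  qed
  have "?s (Suc (Suc n)) - ?s (Suc n) = (1/2) *\<^sub>R ((?s (Suc n) o\<^sub>L ?s (Suc n)) - (?s n o\<^sub>L ?s n))"
    by (rule halves) (rule sqrt_step.simps(2))+
  also have "(?s (Suc n) o\<^sub>L ?s (Suc n)) - (?s n o\<^sub>L ?s n) = (?d o\<^sub>L ?s (Suc n)) + (?s n o\<^sub>L ?d)"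
    by (intro blinfun_eqI) (simp add: blinfun.bilinear_simps del: sqrt_step.simps)
  also have "norm ((1/2) *\<^sub>R ((?d o\<^sub>L ?s (Suc n)) + (?s n o\<^sub>L ?d)))
      \<le> 1/2 * (norm (?d o\<^sub>L ?s (Suc n)) + norm (?s n o\<^sub>L ?d))"
    using norm_triangle_ineq[of "?d o\<^sub>L ?s (Suc n)" "(?s n o\<^sub>L ?d)"] by (simp del: sqrt_step.simps)
  also have "\<dots> \<le> 1/2 * (norm ?d * norm (?s (Suc n)) + norm (?s n) * norm ?d)"
    using norm_blinfun_compose[of ?d "?s (Suc n)"] norm_blinfun_compose[of "?s n" ?d]
    by (simp del: sqrt_step.simps)
  also have "\<dots> \<le> 1/2 * ((?m (Suc n) - ?m n) * ?m (Suc n) + ?m n * (?m (Suc n) - ?m n))"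
    using Suc.IH norm_sqrt_step_le[OF assms] sqrt_majorant_bounds order_trans[OF norm_ge_zero Suc.IH]
    by (intro mult_left_mono add_mono mult_mono) (auto simp del: sqrt_step.simps sqrt_majorant.simps)
  also have "\<dots> = ?m (Suc (Suc n)) - ?m (Suc n)"
    by (rule difference) (rule sqrt_majorant.simps(2))+
  finally show ?case .
qed

definition one_minus_sqrt :: "('a::banach \<Rightarrow>\<^sub>L 'a) \<Rightarrow> 'a \<Rightarrow>\<^sub>L 'a" where
  "one_minus_sqrt y = lim (sqrt_step y)"

lemma
  assumes "norm (y :: 'a::banach \<Rightarrow>\<^sub>L 'a) \<le> 1"
  shows sqrt_step_tendsto: "sqrt_step y \<longlonglongrightarrow> one_minus_sqrt y"
    and one_minus_sqrt_error: "norm (one_minus_sqrt y - sqrt_step y n) \<le> 1 - sqrt_majorant n"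
proof -
  obtain L where L: "sqrt_step y \<longlonglongrightarrow> L" "\<And>n. norm (L - sqrt_step y n) \<le> 1 - sqrt_majorant n"
    using majorized_sequence_converges[OF norm_sqrt_step_diff_le[OF assms] sqrt_majorant_tendsto] by blast
  then have "one_minus_sqrt y = L" unfolding one_minus_sqrt_def by (simp add: limI)
  with L show "sqrt_step y \<longlonglongrightarrow> one_minus_sqrt y"
    "norm (one_minus_sqrt y - sqrt_step y n) \<le> 1 - sqrt_majorant n" by auto
qed

lemma one_minus_sqrt_square:
  assumes "norm (y :: 'a::banach \<Rightarrow>\<^sub>L 'a) \<le> 1"
  defines "r \<equiv> id_blinfun - one_minus_sqrt y"
  shows "(r o\<^sub>L r) = id_blinfun - y"
proof -
  let ?s = "one_minus_sqrt y"
  note lim = sqrt_step_tendsto[OF assms(1)]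
  have "(\<lambda>n. sqrt_step y (Suc n)) \<longlonglongrightarrow> (1/2) *\<^sub>R (y + (?s o\<^sub>L ?s))"
    unfolding sqrt_step.simps by (intro tendsto_intros lim bounded_bilinear.tendsto[OF bounded_bilinear_blinfun_compose])
  with LIMSEQ_Suc[OF lim] have eq: "?s = (1/2) *\<^sub>R (y + (?s o\<^sub>L ?s))" using LIMSEQ_unique by blast
  have "2 *\<^sub>R ?s x = y x + ?s (?s x)" for x
    using arg_cong[OF eq, of "\<lambda>T. 2 *\<^sub>R blinfun_apply T x"] by (simp add: blinfun.bilinear_simps)
  then show ?thesis
    unfolding r_def by (intro blinfun_eqI) (simp add: blinfun.bilinear_simps scaleR_2 algebra_simps)
qed

lemma norm_one_minus_sqrt_le:
  assumes "norm (y :: 'a::banach \<Rightarrow>\<^sub>L 'a) \<le> 1"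
  shows "norm (one_minus_sqrt y) \<le> norm y"
proof (rule tendsto_upperbound[OF tendsto_norm[OF sqrt_step_tendsto[OF assms]]])
  have "norm (sqrt_step y n) \<le> norm y" for n
  proof (induction n)
    case (Suc n)
    have "norm (sqrt_step y n o\<^sub>L sqrt_step y n) \<le> norm (sqrt_step y n) * norm (sqrt_step y n)"
      by (rule norm_blinfun_compose)
    also have "\<dots> \<le> 1 * norm y"
      using Suc.IH assms by (intro mult_mono) auto
    finally show ?case
      using norm_triangle_ineq[of y "(sqrt_step y n o\<^sub>L sqrt_step y n)"] by simp
  qed simp
  then show "\<forall>\<^sub>F n in sequentially. norm (sqrt_step y n) \<le> norm y" by simp
qed simp

lemma tendsto_blinfun_apply_at:
  "T \<longlonglongrightarrow> S \<Longrightarrow> (\<lambda>n. blinfun_apply (T n) x) \<longlonglongrightarrow> S x"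
  by (intro tendsto_intros)

text \<open>
  A square root is a limit of polynomials in the operator, so it inherits whatever survives sums,
  products and limits: invariant closed subspaces here, commuting operators and self-adjointness below.
\<close>

lemma one_minus_sqrt_invariant:
  assumes y: "norm (y :: 'a::banach \<Rightarrow>\<^sub>L 'a) \<le> 1"
    and E: "subspace E" "closed E" "\<And>x. x \<in> E \<Longrightarrow> y x \<in> E" and "x \<in> E"
  shows "one_minus_sqrt y x \<in> E"
proof -
  have "sqrt_step y n x \<in> E" if "x \<in> E" for n x
    using that
  proof (induction n arbitrary: x)
    case 0
    then show ?case by (simp add: subspace_0 E)
  next
    case (Suc n)
    then show ?case
      by (simp add: blinfun.bilinear_simps subspace_add subspace_scale E del: scaleR_add_right)
  qed
  then show ?thesis
    using closed_sequentially[OF E(2) _ tendsto_blinfun_apply_at[OF sqrt_step_tendsto[OF y], of x]] \<open>x \<in> E\<close>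
    by simp
qed

lemma one_minus_sqrt_commute:
  assumes y: "norm (y :: 'a::banach \<Rightarrow>\<^sub>L 'a) \<le> 1" and S: "\<And>x. blinfun_apply S (y x) = y (S x)"
  shows "blinfun_apply S (one_minus_sqrt y x) = one_minus_sqrt y (S x)"
proof -
  have "S (sqrt_step y n x) = sqrt_step y n (S x)" for n x
    by (induction n arbitrary: x) (simp_all add: blinfun.bilinear_simps S)
  moreover have "(\<lambda>n. blinfun_apply S (sqrt_step y n x)) \<longlonglongrightarrow> S (one_minus_sqrt y x)"
    by (intro tendsto_intros tendsto_blinfun_apply_at sqrt_step_tendsto y)
  moreover have "(\<lambda>n. sqrt_step y n (S x)) \<longlonglongrightarrow> one_minus_sqrt y (S x)"
    by (intro tendsto_blinfun_apply_at sqrt_step_tendsto y)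
  ultimately show ?thesis using LIMSEQ_unique by simp
qed

lemma continuous_on_one_minus_sqrt:
  "continuous_on {y :: 'a::banach \<Rightarrow>\<^sub>L 'a. norm y \<le> 1} one_minus_sqrt"
proof (rule uniform_limit_theorem)
  have "continuous_on A (\<lambda>y. sqrt_step y n)" for n and A :: "('a \<Rightarrow>\<^sub>L 'a) set"
    by (induction n) (auto intro!: continuous_intros bounded_bilinear.continuous_on[OF bounded_bilinear_blinfun_compose])
  then show "\<forall>\<^sub>F n in sequentially. continuous_on {y :: 'a \<Rightarrow>\<^sub>L 'a. norm y \<le> 1} (\<lambda>y. sqrt_step y n)"
    by simp
  show "uniform_limit {y :: 'a \<Rightarrow>\<^sub>L 'a. norm y \<le> 1} (\<lambda>n y. sqrt_step y n) one_minus_sqrt sequentially"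
  proof (rule uniform_limitI)
    fix e :: real assume "e > 0"
    then have "\<forall>\<^sub>F n in sequentially. sqrt_majorant n > 1 - e"
      by (intro order_tendstoD(1)[OF sqrt_majorant_tendsto]) auto
    then show "\<forall>\<^sub>F n in sequentially. \<forall>y\<in>{y :: 'a \<Rightarrow>\<^sub>L 'a. norm y \<le> 1}. dist (sqrt_step y n) (one_minus_sqrt y) < e"
    proof (rule eventually_mono)
      fix n assume "1 - e < sqrt_majorant n"
      then show "\<forall>y\<in>{y :: 'a \<Rightarrow>\<^sub>L 'a. norm y \<le> 1}. dist (sqrt_step y n) (one_minus_sqrt y) < e"
        using one_minus_sqrt_error[of _ n] by (force simp: dist_norm norm_minus_commute)
    qed
  qed
qed simp

section \<open>Self-adjoint multipliers and their absolute values\<close>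

text \<open>
  If $M(A)$ denotes the multiplier algebra, this says that $T$ lies in it and equals its
  adjoint. The identity and the left multiplications by self-adjoint elements are the examples in use.
\<close>

definition selfadj :: "('a::cstar_algebra \<Rightarrow>\<^sub>L 'a) \<Rightarrow> bool" where
  "selfadj T \<longleftrightarrow> (\<forall>x z. adj (T x) * z = adj x * T z)"

lemma selfadjD: "selfadj T \<Longrightarrow> adj (T x) * z = adj x * T z"
  by (simp add: selfadj_def)

lemma selfadj_zero: "selfadj 0" and selfadj_id: "selfadj id_blinfun"
  by (simp_all add: selfadj_def)

lemma selfadj_add: "selfadj S \<Longrightarrow> selfadj T \<Longrightarrow> selfadj (S + T)"
  and selfadj_diff: "selfadj S \<Longrightarrow> selfadj T \<Longrightarrow> selfadj (S - T)"
  and selfadj_scaleR: "selfadj T \<Longrightarrow> selfadj (r *\<^sub>R T)"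
  by (simp_all add: selfadj_def blinfun.bilinear_simps adj_add adj_diff adj_scaleR algebra_simps)

lemma selfadj_square: "selfadj T \<Longrightarrow> selfadj (T o\<^sub>L T)"
  by (simp add: selfadj_def)

lemma selfadj_mult_left: "adj h = h \<Longrightarrow> selfadj (blinfun_mult_right h)"
  by (simp add: selfadj_def adj_mult mult.assoc)

lemma selfadj_one_minus_sqrt:
  assumes "norm y \<le> 1" "selfadj y"
  shows "selfadj (one_minus_sqrt y)"
proof -
  have "selfadj (sqrt_step y n)" for n
    by (induction n) (auto intro!: selfadj_zero selfadj_add selfadj_scaleR selfadj_square assms(2) simp del: scaleR_add_right)
  note step = selfadjD[OF this]
  show ?thesis
    unfolding selfadj_def
  proof (intro allI)
    fix x z
    note lim = tendsto_blinfun_apply_at[OF sqrt_step_tendsto[OF assms(1)]]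
    have "(\<lambda>n. adj (sqrt_step y n x) * z) \<longlonglongrightarrow> adj (one_minus_sqrt y x) * z"
      by (intro tendsto_intros lim bounded_linear.tendsto[OF bounded_linear_adj])
    moreover have "(\<lambda>n. adj x * sqrt_step y n z) \<longlonglongrightarrow> adj x * one_minus_sqrt y z"
      by (intro tendsto_intros lim)
    ultimately show "adj (one_minus_sqrt y x) * z = adj x * one_minus_sqrt y z"
      using LIMSEQ_unique step by simp
  qed
qed

lemma adj_scaleC_i: "adj (\<i> *\<^sub>C x) = - (\<i> *\<^sub>C adj (x :: 'a::cstar_algebra))"
  using scaleC_scaleC[of "-1" \<i> "adj x"] by (simp add: adj_scaleC scaleC_minus_one)

lemma complex_product:
  fixes p q r s :: "'a::complex_algebra"
  shows "(p - \<i> *\<^sub>C q) * (r + \<i> *\<^sub>C s) = p * r + q * s + \<i> *\<^sub>C (p * s - q * r)"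
proof -
  have "(p - \<i> *\<^sub>C q) * (r + \<i> *\<^sub>C s)
      = (p * r + p * (\<i> *\<^sub>C s)) - ((\<i> *\<^sub>C q) * r + (\<i> *\<^sub>C q) * (\<i> *\<^sub>C s))"
    by (simp add: left_diff_distrib distrib_left)
  also have "(\<i> *\<^sub>C q) * (\<i> *\<^sub>C s) = - (q * s)"
    by (simp only: mult_scaleC_left mult_scaleC_right scaleC_i_i)
  finally show ?thesis by (simp add: mult_scaleC_left mult_scaleC_right scaleC_diff_right)
qed

text \<open>
  $S + iT$ is unitary, as $(S - iT)(S + iT) = S^2 + T^2$ for commuting $S$ and $T$.
\<close>

lemma isometry_of_commuting_squares:
  assumes ST: "selfadj S" "selfadj T" and comm: "\<And>x. blinfun_apply S (blinfun_apply T x) = T (S x)"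
    and sum: "(S o\<^sub>L S) + (T o\<^sub>L T) = id_blinfun"
  shows "norm (S x + \<i> *\<^sub>C T x) = norm x"
proof -
  have "adj (S x + \<i> *\<^sub>C T x) * (S x + \<i> *\<^sub>C T x)
      = adj (S x) * S x + adj (T x) * T x + \<i> *\<^sub>C (adj (S x) * T x - adj (T x) * S x)"
    unfolding adj_add adj_scaleC_i by (simp add: complex_product)
  also have "adj (S x) * T x = adj (T x) * S x"
    using ST by (simp add: selfadjD comm)
  also have "adj (S x) * S x + adj (T x) * T x = adj x * ((S o\<^sub>L S) + (T o\<^sub>L T)) x"
    using ST by (simp add: selfadjD blinfun.bilinear_simps distrib_left)
  finally have "adj (S x + \<i> *\<^sub>C T x) * (S x + \<i> *\<^sub>C T x) = adj x * x" using sum by simp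
  then have "(norm (S x + \<i> *\<^sub>C T x))\<^sup>2 = (norm x)\<^sup>2" using cstar_identity by metis
  then show ?thesis by simp
qed

text \<open>
  This inequality carries all spectral information about self-adjoint elements that the proof
  needs. With $R = \sqrt{1 - T^2}$ both $T + iR$ and $T - iR$ are isometries, so $R$, as half the norm
  of their difference, is a contraction, and $1 - T^2 = R^2$.
\<close>

lemma norm_id_minus_square_le:
  fixes T :: "'a::cstar_algebra \<Rightarrow>\<^sub>L 'a"
  assumes T: "selfadj T" "norm T \<le> 1"
  shows "norm (id_blinfun - (T o\<^sub>L T)) \<le> 1"
proof -
  have y: "norm (T o\<^sub>L T) \<le> 1"
    using norm_blinfun_compose[of T T] mult_le_one[of "norm T" "norm T"] T(2) by simp
  define R where "R = id_blinfun - one_minus_sqrt (T o\<^sub>L T)"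
  have RR: "(R o\<^sub>L R) = id_blinfun - (T o\<^sub>L T)"
    unfolding R_def by (rule one_minus_sqrt_square[OF y])
  have R: "selfadj R"
    unfolding R_def by (intro selfadj_diff selfadj_id selfadj_one_minus_sqrt y selfadj_square T)
  have comm: "T (R x) = R (T x)" for x
    unfolding R_def using one_minus_sqrt_commute[OF y, of T] by (simp add: blinfun.bilinear_simps)
  have iso: "norm (T x + \<i> *\<^sub>C R x) = norm x" for x
    by (rule isometry_of_commuting_squares[OF T(1) R comm]) (simp add: RR)
  have iso': "norm (T x - \<i> *\<^sub>C R x) = norm x" for x
  proof -
    have "selfadj (- R)" using selfadj_diff[OF selfadj_zero R] by simp
    moreover have "(T o\<^sub>L T) + ((- R) o\<^sub>L (- R)) = id_blinfun"
      using arg_cong[OF RR, of blinfun_apply]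
      by (intro blinfun_eqI) (simp add: blinfun.bilinear_simps fun_eq_iff)
    ultimately have "norm (T x + \<i> *\<^sub>C (- R) x) = norm x"
      by (intro isometry_of_commuting_squares T(1)) (simp_all add: blinfun.bilinear_simps comm)
    then show ?thesis by (simp add: scaleC_minus_right blinfun.bilinear_simps)
  qed
  have "norm (R x) \<le> norm x" for x
  proof -
    have "2 * norm (R x) = norm ((2 * \<i>) *\<^sub>C R x)" by (simp add: norm_scaleC norm_mult)
    also have "(2 * \<i>) *\<^sub>C R x = (T x + \<i> *\<^sub>C R x) - (T x - \<i> *\<^sub>C R x)"
      using scaleC_add_left[of \<i> \<i> "R x"] by simp
    also have "norm \<dots> \<le> norm x + norm x"
      using norm_triangle_ineq4[of "T x + \<i> *\<^sub>C R x" "T x - \<i> *\<^sub>C R x"] by (simp only: iso iso')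
    finally show ?thesis by simp
  qed
  then have "norm (R (R x)) \<le> norm x" for x by (meson order_trans)
  then show ?thesis
    unfolding RR[symmetric] by (intro norm_blinfun_bound) auto
qed

text \<open>
  The square root of $T^2 = 1 - (1 - T^2)$, where $1 - T^2$ is a contraction as soon as $T$ is one.
\<close>

definition mult_abs :: "('a::cstar_algebra \<Rightarrow>\<^sub>L 'a) \<Rightarrow> 'a \<Rightarrow>\<^sub>L 'a" where
  "mult_abs T = id_blinfun - one_minus_sqrt (id_blinfun - (T o\<^sub>L T))"

lemma mult_abs_minus: "mult_abs (- T) = mult_abs T"
proof -
  have "((- T) o\<^sub>L (- T)) = (T o\<^sub>L T)" by (intro blinfun_eqI) (simp add: blinfun.bilinear_simps)
  then show ?thesis by (simp add: mult_abs_def)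
qed

context
  fixes T :: "'a::cstar_algebra \<Rightarrow>\<^sub>L 'a"
  assumes T: "selfadj T" "norm T \<le> 1"
begin

lemma selfadj_mult_abs: "selfadj (mult_abs T)"
  unfolding mult_abs_def
  by (intro selfadj_diff selfadj_id selfadj_one_minus_sqrt norm_id_minus_square_le selfadj_square T)

lemma mult_abs_square: "mult_abs T (mult_abs T x) = T (T x)"
  using arg_cong[OF one_minus_sqrt_square[OF norm_id_minus_square_le[OF T]], of "\<lambda>S. blinfun_apply S x"]
  by (simp add: mult_abs_def blinfun.bilinear_simps)

lemma mult_abs_commute: "mult_abs T (T x) = T (mult_abs T x)"
  using one_minus_sqrt_commute[OF norm_id_minus_square_le[OF T], of T x]
  by (simp add: mult_abs_def blinfun.bilinear_simps)

lemma mult_abs_invariant: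
  assumes E: "subspace E" "closed E" "\<And>x. x \<in> E \<Longrightarrow> T x \<in> E" and "x \<in> E"
  shows "mult_abs T x \<in> E"
  using one_minus_sqrt_invariant[OF norm_id_minus_square_le[OF T], of E x] assms
  by (simp add: mult_abs_def blinfun.bilinear_simps subspace_diff)

text \<open>
  $(|T| - T)(|T| + T) = 0$, and $|T| + T$ is so close to $2$ that it is injective.
\<close>

lemma mult_abs_near_id:
  assumes near: "norm (id_blinfun - T) \<le> 1/4"
  shows "mult_abs T = T"
proof -
  let ?U = "mult_abs T"
  have "id_blinfun - (T o\<^sub>L T) = ((id_blinfun - T) o\<^sub>L (id_blinfun + T))"
    by (intro blinfun_eqI) (simp add: blinfun.bilinear_simps)
  then have "norm (id_blinfun - (T o\<^sub>L T)) \<le> norm (id_blinfun - T) * norm (id_blinfun + T)"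
    by (metis norm_blinfun_compose)
  also have "\<dots> \<le> 1/4 * 2"
    using near T(2) norm_triangle_ineq[of id_blinfun T] norm_blinfun_id_le[where 'a='a]
    by (intro mult_mono) auto
  finally have U: "norm (id_blinfun - ?U) \<le> 1/2"
    using norm_one_minus_sqrt_le[OF norm_id_minus_square_le[OF T]] by (simp add: mult_abs_def)
  have "?U x = T x" for x
  proof -
    define w where "w = ?U x - T x"
    have "?U w + T w = 0"
      by (simp add: w_def blinfun.bilinear_simps mult_abs_square mult_abs_commute)
    then have "2 *\<^sub>R w = (id_blinfun - ?U) w + (id_blinfun - T) w"
      by (simp add: blinfun.bilinear_simps scaleR_2 algebra_simps)
    then have "norm (2 *\<^sub>R w) \<le> norm ((id_blinfun - ?U) w) + norm ((id_blinfun - T) w)"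
      by (metis norm_triangle_ineq)
    also have "\<dots> \<le> 1/2 * norm w + 1/4 * norm w"
      using U near by (intro add_mono order_trans[OF norm_blinfun] mult_right_mono) auto
    finally have "w = 0" by simp
    then show ?thesis by (simp add: w_def)
  qed
  then show ?thesis by (intro blinfun_eqI)
qed

end

lemma continuous_on_mult_abs:
  "continuous_on {T :: 'a::cstar_algebra \<Rightarrow>\<^sub>L 'a. selfadj T \<and> norm T \<le> 1} mult_abs"
proof -
  have "continuous_on {T :: 'a \<Rightarrow>\<^sub>L 'a. selfadj T \<and> norm T \<le> 1}
          (\<lambda>T. one_minus_sqrt (id_blinfun - (T o\<^sub>L T)))"
    by (rule continuous_on_compose2[OF continuous_on_one_minus_sqrt])
       (auto intro!: continuous_intros bounded_bilinear.continuous_on[OF bounded_bilinear_blinfun_compose]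
         norm_id_minus_square_le)
  then show ?thesis unfolding mult_abs_def by (intro continuous_intros)
qed

section \<open>Approximate units in closed ideals\<close>

text \<open>
  In the unitization of the algebra the condition reads $\|1 - e\| \le 1$. It
  passes to products $(1 - f)(1 - e)$, which is how approximate units for single elements combine
  into approximate units for finitely many (\<open>contractive_circle\<close>).
\<close>

definition contractive :: "'a::cstar_algebra \<Rightarrow> bool" where
  "contractive e \<longleftrightarrow> (\<forall>x. norm (x - e * x) \<le> norm x)"

lemma contractiveD: "contractive e \<Longrightarrow> norm (x - e * x) \<le> norm x"
  by (simp add: contractive_def)

lemma norm_contractive_le:
  assumes "contractive e" shows "norm e \<le> 2"
proof (cases "e = 0")
  case False
  have "e * adj e = adj e - (adj e - e * adj e)" by simp
  then have "norm (e * adj e) \<le> norm (adj e) + norm (adj e - e * adj e)"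
    by (metis norm_triangle_ineq4)
  also have "\<dots> \<le> 2 * norm e" using contractiveD[OF assms, of "adj e"] by simp
  finally have "norm e * norm e \<le> 2 * norm e" by (simp add: cstar_identity_right power2_eq_square)
  then show ?thesis using False by simp
qed simp

lemma contractive_circle:
  assumes "contractive e" "contractive f"
  shows "contractive (f + e - f * e)"
  unfolding contractive_def
proof
  fix x
  have "x - (f + e - f * e) * x = (x - e * x) - f * (x - e * x)"
    by (simp add: algebra_simps)
  then show "norm (x - (f + e - f * e) * x) \<le> norm x"
    using order_trans[OF contractiveD[OF assms(2), of "x - e * x"] contractiveD[OF assms(1), of x]]
    by (simp only:)
qed

text \<open>
  This trades approximating $u$ for approximating $uu^*$. Iterating it reaches $h^4$ from $h$, for
  which an approximate unit is easy to write down.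
\<close>

lemma contractive_selfadj_square:
  fixes u :: "'a::cstar_algebra"
  assumes e: "contractive e" "adj e = e"
  shows "(norm (u - e * u))\<^sup>2 \<le> norm (u * adj u - e * (u * adj u))"
proof -
  define y where "y = u * adj u - e * (u * adj u)"
  have "(u - e * u) * adj (u - e * u) = y - y * e"
    by (simp add: y_def adj_diff adj_mult e algebra_simps)
  also have "\<dots> = adj (adj y - e * adj y)" by (simp add: adj_diff adj_mult adj_adj e)
  finally have "(norm (u - e * u))\<^sup>2 = norm (adj y - e * adj y)"
    using cstar_identity_right[of "u - e * u"] by simp
  also have "\<dots> \<le> norm y" using contractiveD[OF e(1), of "adj y"] by simp
  finally show ?thesis by (simp add: y_def)
qed

locale closed_ideal =
  fixes J :: "'a::cstar_algebra set"
  assumes subspace_J: "subspace J" and closed_J: "closed J"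
    and mult_left_J: "\<And>a b. a \<in> J \<Longrightarrow> b * a \<in> J"
    and mult_right_J: "\<And>a b. a \<in> J \<Longrightarrow> a * b \<in> J"
begin

lemmas zero_J = subspace_0[OF subspace_J]
  and add_J = subspace_add[OF subspace_J]
  and diff_J = subspace_diff[OF subspace_J]
  and scale_J = subspace_scale[OF subspace_J]
  and minus_J = subspace_neg[OF subspace_J]

text \<open>
  $V = 1 - h^2$ is a contraction, so the same holds for the Cesaro mean $W = \frac1N\sum_{k<N} V^k$, and
  $W h^2 = \frac1N(1 - V^N)$ is of norm at most $2/N$. Since $V^k = 1 - f_k$ with $f_k$ in the ideal,
  $W = 1 - e$ with $e$ in the ideal.
\<close>

lemma cesaro_unit:
  assumes h: "adj h = h" "norm h \<le> 1" "h \<in> J" and N: "N > 0"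
  obtains e where "e \<in> J" "contractive e" "adj e = e" 
    "norm (h * h - e * (h * h)) ^ 2 \<le> 2 / real N"
proof -
  define f where "f = rec_nat 0 (\<lambda>_ e. e + h * h - h * h * e)"
  have f: "f 0 = 0" "f (Suc k) = f k + h * h - h * h * f k" for k
    by (simp_all add: f_def)
  have fJ: "f k \<in> J" for k
    by (induction k) (simp_all add: f zero_J add_J diff_J mult_right_J mult_left_J h)
  have comm: "f k * (h * h) = h * h * f k" for k
    by (induction k) (simp_all add: f algebra_simps)
  have fadj: "adj (f k) = f k" for k
    by (induction k) (simp_all add: f adj_add adj_diff adj_mult h comm)
  have V: "norm (id_blinfun - (blinfun_mult_right h o\<^sub>L blinfun_mult_right h)) \<le> 1"
  proof (rule norm_id_minus_square_le)
    show "selfadj (blinfun_mult_right h)" using h by (simp add: selfadj_mult_left)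
    show "norm (blinfun_mult_right h) \<le> 1"
    proof (rule norm_blinfun_bound)
      fix x
      show "norm (blinfun_mult_right h x) \<le> 1 * norm x"
        using norm_mult_ineq[of h x] mult_right_mono[OF h(2), of "norm x"] by simp
    qed simp
  qed
  have Vx: "norm (x - h * (h * x)) \<le> norm x" for x
    using order_trans[OF norm_blinfun mult_right_mono[OF V norm_ge_zero], of x]
    by (simp add: blinfun.bilinear_simps)
  have fk: "norm (x - f k * x) \<le> norm x" for k x
  proof (induction k)
    case (Suc k)
    have "x - f (Suc k) * x = (x - f k * x) - h * (h * (x - f k * x))"
      by (simp add: f algebra_simps)
    then show ?case using order_trans[OF Vx[of "x - f k * x"] Suc.IH] by (simp only:)
  qed (simp add: f)
  have tele: "(\<Sum>k<n. h * h * (x - f k * x)) = f n * x" for n x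
    by (induction n) (simp_all add: f algebra_simps)
  define e where "e = (1 / real N) *\<^sub>R (\<Sum>k<N. f k)"
  have e1: "x - e * x = (1 / real N) *\<^sub>R (\<Sum>k<N. x - f k * x)" for x
    using N by (simp add: e_def sum_subtractf sum_distrib_right scaleR_diff_right scaleR_sum_right sum_constant_scaleR)
  show thesis
  proof
    show "e \<in> J" unfolding e_def by (intro scale_J subspace_sum[OF subspace_J] fJ)
    have "adj (\<Sum>k<n. f k) = (\<Sum>k<n. f k)" for n
      by (induction n) (simp_all add: adj_add fadj)
    then show eadj: "adj e = e" by (simp add: e_def adj_scaleR)
    show con: "contractive e"
      unfolding contractive_def
    proof
      fix x
      have "norm (\<Sum>k<N. x - f k * x) \<le> (\<Sum>k<N. norm x)"
        by (intro sum_norm_le fk)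
      then show "norm (x - e * x) \<le> norm x" using N by (simp add: e1 field_simps)
    qed
    have "f n * x = x - (x - f n * x)" for n x by simp
    then have fN: "norm (f n * x) \<le> 2 * norm x" for n x
      using fk[of x n] norm_triangle_ineq4[of x "x - f n * x"] by simp
    \<comment> \<open>One factor $h^2$ is consumed by the telescoping sum. The other one stands in for a unit,
      to which the operator bound would otherwise be applied.\<close>
    have "h * h * (h * h) - e * (h * h * (h * h)) = h * h * (h * h - e * (h * h))"
    proof -
      define q where "q = h * h"
      have "e * q = q * e"
        by (simp add: q_def e_def sum_distrib_left sum_distrib_right comm)
      then have "e * q * q = q * e * q" by simp
      then have "e * (q * q) = q * (e * q)" by (simp only: mult.assoc)
      then show ?thesis by (simp add: right_diff_distrib flip: q_def)
    qed
    also have "\<dots> = (1 / real N) *\<^sub>R (\<Sum>k<N. h * h * (h * h - f k * (h * h)))"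
      by (simp only: e1 mult_scaleR_right sum_distrib_left)
    also have "\<dots> = (1 / real N) *\<^sub>R (f N * (h * h))"
      by (simp only: tele)
    also have "norm \<dots> \<le> 2 / real N * norm (h * h)"
      using fN[of N "h * h"] N by (simp add: field_simps)
    also have "\<dots> \<le> 2 / real N * 1"
      using h(2) norm_mult_ineq[of h h] mult_le_one[of "norm h" "norm h"] N by (intro mult_left_mono) auto
    finally show "norm (h * h - e * (h * h)) ^ 2 \<le> 2 / real N"
      using contractive_selfadj_square[OF con eadj, of "h * h"] by (simp add: adj_mult h)
  qed
qed

text \<open>
  The unit comes from the powers of $h = uu^*/\|u\|^2$, hence it lies in the ideal as soon as $uu^*$ does.
  Membership of $u$ itself is then a consequence (\<open>mem_if_mult_adj_mem\<close>).
\<close>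

lemma approximate_unit_single:
  assumes u: "u * adj u \<in> J" and eps: "\<epsilon> > 0"
  obtains e where "e \<in> J" "contractive e" "norm (u - e * u) < \<epsilon>"
proof (cases "u = 0")
  case True
  then show ?thesis using that[of 0] eps by (simp add: contractive_def zero_J)
next
  case False
  define h where "h = (1 / (norm u)\<^sup>2) *\<^sub>R (u * adj u)"
  have h: "adj h = h" "norm h \<le> 1" "h \<in> J"
    using False u by (simp_all add: h_def adj_scaleR adj_mult adj_adj cstar_identity_right scale_J)
  \<comment> \<open>Passing from $u$ to $h$, $h^2$ and $h^4$ takes three squarings, hence the eighth powers.\<close>
  obtain N :: nat where N: "N > 0" "(norm u) ^ 8 * 2 / \<epsilon> ^ 8 < real N"
  proof -
    obtain N :: nat where N: "(norm u) ^ 8 * 2 / \<epsilon> ^ 8 < real N" using reals_Archimedean2 by blast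
    have "0 \<le> (norm u) ^ 8 * 2 / \<epsilon> ^ 8" using eps by simp
    from le_less_trans[OF this N] N that[of N] show ?thesis by simp
  qed
  obtain e where e: "e \<in> J" "contractive e" "adj e = e"
    and le: "norm (h * h - e * (h * h)) ^ 2 \<le> 2 / real N"
    using cesaro_unit[OF h N(1)] by blast
  have "norm (u - e * u) ^ 2 \<le> norm (u * adj u - e * (u * adj u))"
    by (rule contractive_selfadj_square[OF e(2,3)])
  also have "u * adj u = (norm u)\<^sup>2 *\<^sub>R h" using False by (simp add: h_def)
  also have "norm ((norm u)\<^sup>2 *\<^sub>R h - e * ((norm u)\<^sup>2 *\<^sub>R h)) = (norm u)\<^sup>2 * norm (h - e * h)"
    by (simp flip: scaleR_diff_right)
  finally have "(norm (u - e * u) ^ 2) ^ 4 \<le> ((norm u)\<^sup>2 * norm (h - e * h)) ^ 4"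
    by (intro power_mono) auto
  then have "norm (u - e * u) ^ 8 \<le> norm u ^ 8 * (norm (h - e * h) ^ 2) ^ 2"
    by (simp add: power_mult_distrib flip: power_mult)
  also have "\<dots> \<le> norm u ^ 8 * norm (h * h - e * (h * h)) ^ 2"
    using contractive_selfadj_square[OF e(2,3), of h]
    by (intro mult_left_mono power_mono) (auto simp: h)
  also have "\<dots> \<le> norm u ^ 8 * (2 / real N)"
    by (intro mult_left_mono le) auto
  also have "\<dots> < \<epsilon> ^ 8" using N eps by (simp add: field_simps)
  finally have "norm (u - e * u) < \<epsilon>" by (rule power_less_imp_less_base) (use eps in auto)
  with e that show ?thesis by blast
qed

text \<open>
  After $1 - e$ has made $u_0, \dots, u_{n-1}$ small, a unit $f$ for $v = (1 - e)u_n$ is chosen. The product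
  $(1 - f)(1 - e)$ works for all of them because $1 - f$ does not increase norms.
\<close>

lemma approximate_unit:
  fixes u :: "nat \<Rightarrow> 'a"
  assumes "\<And>k. k < n \<Longrightarrow> u k \<in> J" "\<epsilon> > 0"
  shows "\<exists>e\<in>J. contractive e \<and> (\<forall>k<n. norm (u k - e * u k) < \<epsilon>)"
proof (insert assms(1), induction n)
  case 0
  show ?case by (intro bexI[of _ 0]) (simp_all add: contractive_def zero_J)
next
  case (Suc n)
  then obtain e where e: "e \<in> J" "contractive e" "\<And>k. k < n \<Longrightarrow> norm (u k - e * u k) < \<epsilon>"
    by (metis less_SucI)
  define v where "v = u n - e * u n"
  have "v * adj v \<in> J" using Suc.prems[of n] by (simp add: v_def diff_J mult_left_J mult_right_J)
  then obtain f where f: "f \<in> J" "contractive f" "norm (v - f * v) < \<epsilon>"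
    using approximate_unit_single[OF _ assms(2)] by blast
  have eq: "x - (f + e - f * e) * x = (x - e * x) - f * (x - e * x)" for x
    by (simp add: algebra_simps)
  show ?case
  proof (intro bexI conjI allI impI)
    show "f + e - f * e \<in> J" by (intro add_J diff_J mult_left_J e f)
    show "contractive (f + e - f * e)" by (rule contractive_circle[OF e(2) f(2)])
    fix k assume "k < Suc n"
    then show "norm (u k - (f + e - f * e) * u k) < \<epsilon>"
      using f(3) e(3)[of k] contractiveD[OF f(2), of "u k - e * u k"]
      by (cases "k = n") (auto simp: eq v_def)
  qed
qed

text \<open>
  In the quotient by the ideal this says that $xx^* = 0$ implies $x = 0$; this
  weak form takes the place of the C*-identity of the quotient norm.
\<close>

lemma mem_if_mult_adj_mem:
  assumes "x * adj x \<in> J" shows "x \<in> J"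
proof -
  have "\<exists>y\<in>J. dist y x < \<epsilon>" if "\<epsilon> > 0" for \<epsilon>
    using approximate_unit_single[OF assms that] mult_right_J
    by (metis dist_norm norm_minus_commute)
  then show ?thesis using closed_J closure_approachable closure_closed by blast
qed

lemma adj_mem: assumes "x \<in> J" shows "adj x \<in> J"
  using mem_if_mult_adj_mem[of "adj x"] assms by (simp add: adj_adj mult_left_J)

lemma adj_mem_iff: "adj x \<in> J \<longleftrightarrow> x \<in> J"
  using adj_mem adj_adj by metis

lemma mem_if_adj_mult_mem: "adj x * x \<in> J \<Longrightarrow> x \<in> J"
  using mem_if_mult_adj_mem[of "adj x"] by (simp add: adj_adj adj_mem_iff)

end

section \<open>Factorization of null sequences\<close>

text \<open>
  $R$ is the inverse of $\frac12(1 + e) = 1 - \frac12(1 - e)$, obtained from the Neumann series.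
\<close>

lemma contractive_resolvent:
  fixes e :: "'a::cstar_algebra"
  assumes e: "contractive e"
  obtains R :: "'a \<Rightarrow>\<^sub>L 'a" where "\<And>x. R x + e * R x = 2 *\<^sub>R x" "norm R \<le> 2"
    "\<And>x. norm (R x - x) \<le> norm (x - e * x)"
proof -
  define W where "W = id_blinfun - blinfun_mult_right e"
  have W: "W x = x - e * x" for x by (simp add: W_def blinfun.bilinear_simps)
  have nW: "norm W \<le> 1" using contractiveD[OF e] by (intro norm_blinfun_bound) (simp_all add: W)
  define r where "r = rec_nat (0 :: 'a \<Rightarrow>\<^sub>L 'a) (\<lambda>_ R. id_blinfun + (1/2) *\<^sub>R (W o\<^sub>L R))"
  have r: "r 0 = 0" "r (Suc k) = id_blinfun + (1/2) *\<^sub>R (W o\<^sub>L r k)" for k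
    by (simp_all add: r_def)
  have step: "norm (r (Suc k) - r k) \<le> 1 * (1/2) ^ k" for k
  proof (induction k)
    case 0
    then show ?case using norm_blinfun_id_le[where 'a='a] by (simp add: r)
  next
    case (Suc k)
    have "r (Suc (Suc k)) - r (Suc k) = (1/2) *\<^sub>R (W o\<^sub>L (r (Suc k) - r k))"
      by (intro blinfun_eqI) (simp add: r(2)[of "Suc k"] r(2)[of k] blinfun.bilinear_simps algebra_simps)
    also have "norm \<dots> \<le> 1/2 * (norm W * norm (r (Suc k) - r k))"
      using norm_blinfun_compose[of W "r (Suc k) - r k"] by simp
    also have "\<dots> \<le> 1/2 * (1 * (1 * (1/2) ^ k))"
      using nW Suc.IH by (intro mult_left_mono mult_mono) auto
    finally show ?case by simp
  qed
  obtain R where R: "r \<longlonglongrightarrow> R"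
    using geometric_steps_converge[OF step] by auto
  have "(\<lambda>k. r (Suc k)) \<longlonglongrightarrow> id_blinfun + (1/2) *\<^sub>R (W o\<^sub>L R)"
    unfolding r by (intro tendsto_intros R bounded_bilinear.tendsto[OF bounded_bilinear_blinfun_compose])
  with LIMSEQ_Suc[OF R] have eq: "R = id_blinfun + (1/2) *\<^sub>R (W o\<^sub>L R)"
    using LIMSEQ_unique by blast
  have Rx: "R x = x + (1/2) *\<^sub>R W (R x)" for x
    using arg_cong[OF eq, of "\<lambda>T. blinfun_apply T x"] by (simp add: blinfun.bilinear_simps)
  have WW: "norm (W x) \<le> norm x" for x using contractiveD[OF e] by (simp add: W)
  show thesis
  proof
    fix x
    have "2 *\<^sub>R R x = 2 *\<^sub>R x + W (R x)"
      using arg_cong[OF Rx[of x], of "\<lambda>y. 2 *\<^sub>R y"] by (simp add: scaleR_add_right)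
    then show "R x + e * R x = 2 *\<^sub>R x" by (simp add: W scaleR_2 algebra_simps)
    have "norm (R x - x) = 1/2 * norm (W (R x - x) + W x)"
      using Rx[of x] by (metis (no_types) add_diff_cancel_left' blinfun.diff_right diff_add_cancel norm_scaleR abs_of_pos zero_less_divide_1_iff zero_less_numeral)
    also have "\<dots> \<le> 1/2 * (norm (R x - x) + norm (W x))"
      using norm_triangle_ineq[of "W (R x - x)" "W x"] WW[of "R x - x"] by simp
    finally show "norm (R x - x) \<le> norm (x - e * x)" by (simp add: W)
  next
    show "norm R \<le> 2"
    proof (rule norm_blinfun_bound)
      fix x
      have "norm (R x) \<le> norm x + 1/2 * norm (W (R x))"
        using Rx[of x] norm_triangle_ineq[of x "(1/2) *\<^sub>R W (R x)"] by simp
      then show "norm (R x) \<le> 2 * norm x" using WW[of "R x"] by simp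
    qed simp
  qed
qed

context closed_ideal begin

text \<open>
  The stages of Cohen's construction: $b_k = 2^{-k} + j$ is an element of the unitization with $j$ in the
  ideal, and $T$ is a right inverse of it.
\<close>

definition factor_state :: "nat \<Rightarrow> 'a \<times> ('a \<Rightarrow>\<^sub>L 'a) \<Rightarrow> bool" where
  "factor_state k = (\<lambda>(j, T). j \<in> J \<and> norm T \<le> 2 ^ k \<and> (\<forall>x. (1/2) ^ k *\<^sub>R blinfun_apply T x + j * blinfun_apply T x = x))"

text \<open>
  $b_{k+1} = \frac12(1 + e)b_k$, where $e$ is an approximate unit for $j$ and $u_0, \dots, u_k$. The former makes
  the ideal parts of the $b_k$ converge, the latter the vectors $T_k u_n$ for each $n$. Since $\|T_k\|$ may grow
  like $2^k$, the approximation is taken to accuracy $4^{-k}$.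
\<close>

lemma factor_state_extend:
  assumes u: "\<And>n. u n \<in> J" and st: "factor_state k (j, T)"
  shows "\<exists>j' T'. factor_state (Suc k) (j', T') \<and> norm (j' - j) \<le> 2 * (1/2) ^ k \<and>
    (\<forall>n\<le>k. norm (T' (u n) - T (u n)) \<le> (1/2) ^ k)"
proof -
  from st have j: "j \<in> J" and T: "norm T \<le> 2 ^ k" and inv: "\<And>x. (1/2) ^ k *\<^sub>R T x + j * T x = x"
    by (auto simp: factor_state_def)
  define v where "v i = (case i of 0 \<Rightarrow> j | Suc n \<Rightarrow> u n)" for i
  have "v i \<in> J" for i by (cases i) (simp_all add: v_def j u)
  then obtain e where e: "e \<in> J" "contractive e"
    and small: "\<And>i. i < Suc (Suc k) \<Longrightarrow> norm (v i - e * v i) < (1/4) ^ k"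
    using approximate_unit[of "Suc (Suc k)" v "(1/4) ^ k"] by auto
  have small_j: "norm (j - e * j) \<le> (1/2) ^ k"
    using small[of 0] power_mono[of "1/4" "1/2::real" k] by (simp add: v_def)
  have small_u: "norm (u n - e * u n) \<le> (1/4) ^ k" if "n \<le> k" for n
    using small[of "Suc n"] that by (simp add: v_def)
  obtain R :: "'a \<Rightarrow>\<^sub>L 'a" where R: "\<And>x. R x + e * R x = 2 *\<^sub>R x" "norm R \<le> 2"
    "\<And>x. norm (R x - x) \<le> norm (x - e * x)"
    using contractive_resolvent[OF e(2)] by blast
  define j' where "j' = (1/2) *\<^sub>R (j + e * j) + ((1/2) * (1/2) ^ k) *\<^sub>R e"
  have "factor_state (Suc k) (j', T o\<^sub>L R)"
    unfolding factor_state_def prod.case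
  proof (intro conjI allI)
    show "j' \<in> J" unfolding j'_def by (intro add_J scale_J mult_left_J j e)
    have "norm (T o\<^sub>L R) \<le> norm T * norm R" by (rule norm_blinfun_compose)
    also have "\<dots> \<le> 2 ^ k * 2" using T R(2) by (intro mult_mono) auto
    finally show "norm (T o\<^sub>L R) \<le> 2 ^ Suc k" by simp
    fix x
    define w where "w = T (R x)"
    have w: "(1/2) ^ k *\<^sub>R w + j * w = R x" using inv[of "R x"] by (simp add: w_def)
    have "(1/2) ^ Suc k *\<^sub>R w + j' * w
        = (1/2) *\<^sub>R (((1/2) ^ k *\<^sub>R w + j * w) + e * ((1/2) ^ k *\<^sub>R w + j * w))"
      by (simp add: j'_def algebra_simps)
    also have "\<dots> = x" unfolding w R(1) by simp
    finally show "(1/2) ^ Suc k *\<^sub>R (T o\<^sub>L R) x + j' * (T o\<^sub>L R) x = x"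
      by (simp add: w_def)
  qed
  moreover have "norm (j' - j) \<le> 2 * (1/2) ^ k"
  proof -
    have half: "j = (1/2) *\<^sub>R j + (1/2) *\<^sub>R j" by (simp flip: scaleR_add_left)
    have "j' - j = ((1/2) * (1/2) ^ k) *\<^sub>R e - (1/2) *\<^sub>R (j - e * j)"
      unfolding j'_def by (subst (3) half) (simp add: algebra_simps)
    then have "norm (j' - j) \<le> 1/2 * (1/2) ^ k * norm e + 1/2 * norm (j - e * j)"
      using norm_triangle_ineq4[of "((1/2) * (1/2) ^ k) *\<^sub>R e" "(1/2) *\<^sub>R (j - e * j)"] by simp
    also have "\<dots> \<le> 1/2 * (1/2) ^ k * 2 + 1/2 * (1/2) ^ k"
      using norm_contractive_le[OF e(2)] small_j by (intro add_mono mult_left_mono) auto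
    also have "\<dots> \<le> 2 * (1/2) ^ k" by simp
    finally show ?thesis .
  qed
  moreover have "norm ((T o\<^sub>L R) (u n) - T (u n)) \<le> (1/2) ^ k" if "n \<le> k" for n
  proof -
    have "norm ((T o\<^sub>L R) (u n) - T (u n)) = norm (T (R (u n) - u n))"
      by (simp add: blinfun.bilinear_simps)
    also have "\<dots> \<le> norm T * norm (R (u n) - u n)" by (rule norm_blinfun)
    also have "\<dots> \<le> 2 ^ k * (1/4) ^ k"
      using T order_trans[OF R(3) small_u[OF that]] by (intro mult_mono) auto
    also have "\<dots> = (1/2) ^ k" by (simp flip: power_mult_distrib)
    finally show ?thesis .
  qed
  ultimately show ?thesis by blast
qed

text \<open>
  In the limit the scalar part $2^{-k}$ of $b_k$ disappears, so $b$ lies in the ideal. The vectors $c_n$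
  are the limits of $T_k u_n$; from stage $n$ on they hardly change, and up to then $\|T_n\| \le 2^n$ is
  compensated by $\|u_n\| \le 4^{-n}$.
\<close>

lemma null_sequence_factorization:
  assumes u: "\<And>n. u n \<in> J" "\<And>n. norm (u n) \<le> (1/4) ^ n"
  obtains b c where "b \<in> J" "\<And>n. u n = b * c n" "\<And>n. norm (c n) \<le> 3 * (1/2) ^ n"
proof -
  have "\<exists>s. \<forall>k. factor_state k (s k) \<and> (norm (fst (s (Suc k)) - fst (s k)) \<le> 2 * (1/2) ^ k \<and>
      (\<forall>n\<le>k. norm (snd (s (Suc k)) (u n) - snd (s k) (u n)) \<le> (1/2) ^ k))"
  proof (rule dependent_nat_choice)
    show "\<exists>s. factor_state 0 s"
      using norm_blinfun_id_le[where 'a='a]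
      by (intro exI[of _ "(0, id_blinfun)"]) (simp add: factor_state_def zero_J)
    fix s k assume "factor_state k s"
    then show "\<exists>t. factor_state (Suc k) t \<and> norm (fst t - fst s) \<le> 2 * (1/2) ^ k \<and>
        (\<forall>n\<le>k. norm (snd t (u n) - snd s (u n)) \<le> (1/2) ^ k)"
      using factor_state_extend[OF u(1), of k "fst s" "snd s"] by auto
  qed
  then obtain s where s: "\<And>k. factor_state k (s k)"
    "\<And>k. norm (fst (s (Suc k)) - fst (s k)) \<le> 2 * (1/2) ^ k"
    "\<And>k n. n \<le> k \<Longrightarrow> norm (snd (s (Suc k)) (u n) - snd (s k) (u n)) \<le> (1/2) ^ k" by blast
  define j T where "j k = fst (s k)" and "T k = snd (s k)" for k
  have jJ: "j k \<in> J" and Tk: "norm (T k) \<le> 2 ^ k"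
    and inv: "(1/2) ^ k *\<^sub>R T k x + j k * T k x = x" for k x
    using s(1)[of k] by (auto simp: factor_state_def j_def T_def split_beta)
  have "norm (j (Suc k) - j k) \<le> 2 * (1/2) ^ k" for k using s(2)[of k] by (simp add: j_def)
  from geometric_steps_converge[of j, OF this] obtain b where b: "j \<longlonglongrightarrow> b" by auto
  have "\<exists>c. (\<lambda>k. T (k + n) (u n)) \<longlonglongrightarrow> c \<and> norm (c - T n (u n)) \<le> 2 * (1/2) ^ n" for n
  proof -
    have "norm (T (Suc k + n) (u n) - T (k + n) (u n)) \<le> (1/2) ^ n * (1/2) ^ k" for k
      using s(3)[of n "k + n"] by (simp add: T_def power_add mult.commute)
    from geometric_steps_converge[of "\<lambda>k. T (k + n) (u n)", OF this]
    obtain c where "(\<lambda>k. T (k + n) (u n)) \<longlonglongrightarrow> c" "\<And>k. norm (c - T (k + n) (u n)) \<le> (1/2) ^ n * (1/2) ^ k / (1 - 1/2)"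
      by auto
    from this(1) this(2)[of 0] show ?thesis by auto
  qed
  then obtain c where c: "\<And>n. (\<lambda>k. T (k + n) (u n)) \<longlonglongrightarrow> c n"
    "\<And>n. norm (c n - T n (u n)) \<le> 2 * (1/2) ^ n" by metis
  show thesis
  proof
    show "b \<in> J" using closed_sequentially[OF closed_J _ b] jJ by blast
    fix n
    have half: "(\<lambda>k. (1/2::real) ^ k) \<longlonglongrightarrow> 0" by (intro LIMSEQ_power_zero) simp
    have "(\<lambda>k. (1/2) ^ (k + n) *\<^sub>R T (k + n) (u n) + j (k + n) * T (k + n) (u n)) \<longlonglongrightarrow> 0 *\<^sub>R c n + b * c n"
      by (intro tendsto_intros c LIMSEQ_ignore_initial_segment b half)
    then show "u n = b * c n" unfolding inv by (simp add: LIMSEQ_const_iff)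
    have "norm (T n (u n)) \<le> norm (T n) * norm (u n)" by (rule norm_blinfun)
    also have "\<dots> \<le> 2 ^ n * (1/4) ^ n" using Tk u(2) by (intro mult_mono) auto
    also have "\<dots> = (1/2) ^ n" by (simp flip: power_mult_distrib)
    finally show "norm (c n) \<le> 3 * (1/2) ^ n"
      using c(2)[of n] norm_triangle_ineq[of "c n - T n (u n)" "T n (u n)"] by simp
  qed
qed

text \<open>
  If $D$ were unbounded there, some $u_n = b c_n$ with $c_n \to 0$ would have $\|D(u_n)\| \ge 4^n$,
  whereas $\|D(bc_n)\|$ is bounded.
\<close>

lemma bounded_on_ideal:
  fixes D :: "'a \<Rightarrow> 'm::real_normed_vector"
  assumes D: "linear D" and bd: "\<And>b. b \<in> J \<Longrightarrow> \<exists>K. \<forall>x. norm (D (b * x)) \<le> K * norm x"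
  obtains K where "K \<ge> 0" "\<And>x. x \<in> J \<Longrightarrow> norm (D x) \<le> K * norm x"
proof (rule ccontr)
  assume neg: "\<not> thesis"
  interpret D: linear D by fact
  have "\<exists>x\<in>J. norm (D x) > 16 ^ n * norm x" for n :: nat
    using that[of "16 ^ n"] neg by (meson not_le zero_le_power zero_le_numeral)
  then obtain x where x: "\<And>n. x n \<in> J" "\<And>n. norm (D (x n)) > 16 ^ n * norm (x n)" by metis
  have x0: "norm (x n) > 0" for n
    using x(2)[of n] D.zero by (cases "x n = 0") auto
  define u where "u n = ((1/4) ^ n / norm (x n)) *\<^sub>R x n" for n
  have u: "u n \<in> J" "norm (u n) \<le> (1/4) ^ n" for n
    using x0[of n] by (simp_all add: u_def scale_J x)
  obtain b c where bc: "b \<in> J" "\<And>n. u n = b * c n" "\<And>n. norm (c n) \<le> 3 * (1/2) ^ n"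
    using null_sequence_factorization[of u, OF u] by metis
  obtain K where K: "\<And>x. norm (D (b * x)) \<le> K * norm x" using bd[OF bc(1)] by blast
  have "4 ^ n \<le> 3 * \<bar>K\<bar>" for n :: nat
  proof -
    have "4 ^ n = (1/4) ^ n / norm (x n) * (16 ^ n * norm (x n))"
      using x0[of n] by (simp flip: power_mult_distrib)
    also have "\<dots> \<le> (1/4) ^ n / norm (x n) * norm (D (x n))"
      using x(2)[of n] x0[of n] by (intro mult_left_mono) auto
    also have "\<dots> = norm (D (u n))" using x0[of n] by (simp add: u_def D.scale)
    also have "\<dots> \<le> K * norm (c n)" unfolding bc(2) by (rule K)
    also have "\<dots> \<le> \<bar>K\<bar> * (3 * 1)"
      using bc(3)[of n] power_le_one[of "1/2::real" n] by (intro mult_mono) auto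
    finally show ?thesis by simp
  qed
  moreover obtain n where "3 * \<bar>K\<bar> < (4::real) ^ n" using real_arch_pow[of "4::real"] by auto
  ultimately show False by (meson not_le)
qed

end

section \<open>Annihilators and atoms modulo a closed ideal\<close>

context closed_ideal begin

definition eq_mod :: "'a \<Rightarrow> 'a \<Rightarrow> bool" (infix "\<doteq>" 50) where
  "x \<doteq> y \<longleftrightarrow> x - y \<in> J"

lemma eq_mod_refl [simp]: "x \<doteq> x"
  by (simp add: eq_mod_def zero_J)

lemma eq_mod_sym: "x \<doteq> y \<Longrightarrow> y \<doteq> x"
  unfolding eq_mod_def by (metis minus_J minus_diff_eq)

lemma eq_mod_trans [trans]: "x \<doteq> y \<Longrightarrow> y \<doteq> z \<Longrightarrow> x \<doteq> z"
  unfolding eq_mod_def by (drule (1) add_J) simp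

lemma eq_mod_zero_iff: "x \<doteq> 0 \<longleftrightarrow> x \<in> J"
  by (simp add: eq_mod_def)

lemma eq_mod_mem_iff:
  assumes "x \<doteq> y" shows "x \<in> J \<longleftrightarrow> y \<in> J"
  using assms eq_mod_sym eq_mod_trans eq_mod_zero_iff by metis

lemma eq_mod_add: "x \<doteq> y \<Longrightarrow> x' \<doteq> y' \<Longrightarrow> x + x' \<doteq> y + y'"
  unfolding eq_mod_def by (drule (1) add_J) (simp add: algebra_simps)

lemma eq_mod_mult_left: "x \<doteq> y \<Longrightarrow> a * x \<doteq> a * y"
  unfolding eq_mod_def by (simp add: mult_left_J flip: right_diff_distrib)

lemma eq_mod_mult_right: "x \<doteq> y \<Longrightarrow> x * a \<doteq> y * a"
  unfolding eq_mod_def by (simp add: mult_right_J flip: left_diff_distrib)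

text \<open>
  Only real scalars are built into the notion of a subspace; complex ones are absorbed by an approximate unit,
  $c(ex) = (ce)x$.
\<close>

lemma scaleC_mem:
  assumes "x \<in> J" shows "c *\<^sub>C x \<in> J"
proof (rule closed_approachable[THEN iffD1, OF closed_J], intro allI impI)
  fix \<epsilon> :: real assume "\<epsilon> > 0"
  then have "\<epsilon> / (cmod c + 1) > 0" by (intro divide_pos_pos) (auto intro: add_nonneg_pos)
  then obtain e where e: "norm (x - e * x) < \<epsilon> / (cmod c + 1)"
    using approximate_unit_single[OF mult_right_J[OF assms]] by metis
  have "dist ((c *\<^sub>C e) * x) (c *\<^sub>C x) = cmod c * norm (x - e * x)"
    by (simp add: dist_norm mult_scaleC_left norm_minus_commute norm_scaleC flip: scaleC_diff_right)
  also have "\<dots> \<le> (cmod c + 1) * norm (x - e * x)"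
    by (intro mult_right_mono) auto
  also have "\<dots> < \<epsilon>"
    using e by (simp add: pos_less_divide_eq add_nonneg_pos mult.commute)
  finally show "\<exists>y\<in>J. dist y (c *\<^sub>C x) < \<epsilon>"
    using mult_left_J[OF assms] by blast
qed

lemma eq_mod_scaleC: "x \<doteq> y \<Longrightarrow> c *\<^sub>C x \<doteq> c *\<^sub>C y"
  unfolding eq_mod_def by (simp add: scaleC_mem flip: scaleC_diff_right)

definition ann :: "'a \<Rightarrow> 'a set" where
  "ann x = {b. b * x \<in> J}"

lemma ann_mult_adj: "ann (f * adj f) = ann f"
proof -
  have "b * f \<in> J" if "b * (f * adj f) \<in> J" for b
  proof (rule mem_if_mult_adj_mem)
    have "(b * f) * adj (b * f) = b * (f * adj f) * adj b" by (simp add: adj_mult mult.assoc)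
    then show "(b * f) * adj (b * f) \<in> J" using mult_right_J[OF that] by simp
  qed
  moreover have "b * (f * adj f) \<in> J" if "b * f \<in> J" for b
    using mult_right_J[OF that, of "adj f"] by (simp add: mult.assoc)
  ultimately show ?thesis by (auto simp: ann_def)
qed

lemma ann_scaleR: "c \<noteq> 0 \<Longrightarrow> ann (c *\<^sub>R x) = ann x"
proof -
  assume c: "c \<noteq> 0"
  have "c *\<^sub>R y \<in> J \<longleftrightarrow> y \<in> J" for y
    using scale_J[of y c] scale_J[of "c *\<^sub>R y" "1 / c"] c by auto
  then show ?thesis by (simp add: ann_def)
qed

text \<open>
  An element $e$ with maximal annihilator is indecomposable: if $P$ and $N$ are the positive and negative parts of
  $z - l$, then $(Ne)^*(Pe) = 0$, so if $Pe$ is not in $J$, then $(Ne)^*$ annihilates $Pe$, hence $e$, hence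
  $Ne$ itself, and $Ne$ is in $J$. So for each real $l$ one of $Pe$, $Ne$ vanishes modulo $J$. Each of the
  two cases describes a closed set of $l$, and far to the right and to the left different ones occur. As an interval
  is connected, both hold for some $l$, and there $(z - l)e$ vanishes modulo $J$.
\<close>

lemma eigenvalue_mod:
  assumes e: "adj e = e" and z: "adj z = z"
    and maximal: "\<And>g. g \<notin> J \<Longrightarrow> ann e \<subseteq> ann g \<Longrightarrow> ann g \<subseteq> ann e"
    and inv: "\<And>b. b \<in> ann e \<Longrightarrow> b * z \<in> ann e"
  obtains l :: real where "z * e \<doteq> l *\<^sub>R e"
proof -
  \<comment> \<open>The double annihilator of $e$ modulo $J$: by the assumption on $z$ it is invariant under $z$,
    and by maximality each of its elements outside $J$ has the same annihilator as $e$.\<close>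
  define E where "E = {x. \<forall>b\<in>ann e. b * x \<in> J}"
  have eE: "e \<in> E" by (simp add: E_def ann_def)
  have zE: "z * x \<in> E" if "x \<in> E" for x
    using that inv by (force simp: E_def mult.assoc[symmetric])
  have sub: "subspace E"
    unfolding subspace_def E_def
    by (auto simp: zero_J distrib_left add_J scale_J)
  have "E = (\<Inter>b\<in>ann e. (\<lambda>x. b * x) -` J)" by (auto simp: E_def)
  then have clE: "closed E"
    by (auto intro!: closed_INT continuous_closed_vimage closed_J continuous_intros)
  \<comment> \<open>Dividing by $R$ makes $z - l$ a contraction $T_l$ whenever $|l| \le \rho$. At the endpoints
    $R(1 \pm T_l) = \|z\| \pm z$, with norm at most $R/4$.\<close>
  define \<rho> R where "\<rho> = 7 * norm z + 1" and "R = 8 * norm z + 1"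
  have R: "R > 0" "\<rho> + norm z = R" "0 < \<rho>" "8 * norm z \<le> R"
    by (simp_all add: R_def \<rho>_def add_nonneg_pos)
  define T where "T l = (1 / R) *\<^sub>R (blinfun_mult_right z - l *\<^sub>R id_blinfun)" for l
  have Tx: "T l x = (1 / R) *\<^sub>R (z * x - l *\<^sub>R x)" for l x
    by (simp add: T_def blinfun.bilinear_simps)
  have Tbound: "norm (T l x) \<le> (norm z + \<bar>l\<bar>) / R * norm x" for l x
  proof -
    have "norm (z * x - l *\<^sub>R x) \<le> (norm z + \<bar>l\<bar>) * norm x"
      using norm_triangle_ineq4[of "z * x" "l *\<^sub>R x"] norm_mult_ineq[of z x]
      by (simp add: distrib_right)
    then show ?thesis using R(1) by (simp add: Tx divide_right_mono)
  qed
  have Tn: "norm (T l) \<le> 1" if "l \<in> {-\<rho>..\<rho>}" for l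
  proof (rule norm_blinfun_bound)
    fix x
    have "(norm z + \<bar>l\<bar>) / R \<le> 1" using that R by (auto simp: divide_le_eq)
    then show "norm (T l x) \<le> 1 * norm x"
      using order_trans[OF Tbound mult_right_mono[OF _ norm_ge_zero]] by blast
  qed simp
  have Ts: "selfadj (T l)" for l
    unfolding T_def by (intro selfadj_scaleR selfadj_diff selfadj_mult_left z selfadj_id)
  have TE: "T l x \<in> E" if "x \<in> E" for l x
    unfolding Tx by (intro subspace_scale subspace_diff sub zE that)
  define U where "U l = mult_abs (T l)" for l
  note abs_facts = selfadj_mult_abs[OF Ts Tn] mult_abs_square[OF Ts Tn] mult_abs_commute[OF Ts Tn]
  have UE: "U l x \<in> E" if "x \<in> E" "l \<in> {-\<rho>..\<rho>}" for l x
    unfolding U_def by (rule mult_abs_invariant[OF Ts Tn sub clE TE]) (use that in auto)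
  have dich: "(U l + T l) e \<in> J \<or> (U l - T l) e \<in> J" if l: "l \<in> {-\<rho>..\<rho>}" for l
  proof -
    let ?x = "(U l + T l) e" and ?y = "(U l - T l) e"
    have xE: "?x \<in> E" and yE: "?y \<in> E"
      using UE[OF eE l] TE[OF eE, of l] sub
      by (simp_all add: blinfun.bilinear_simps subspace_add subspace_diff)
    have "selfadj (U l - T l)" using abs_facts(1)[OF l] Ts by (simp add: U_def selfadj_diff)
    then have "adj ?y * ?x = adj e * (U l - T l) ?x" by (rule selfadjD)
    also have "(U l - T l) ?x = 0"
      using abs_facts(2,3)[OF l] by (simp add: U_def blinfun.bilinear_simps)
    finally have "adj ?y \<in> ann ?x" by (simp add: ann_def zero_J)
    moreover have "ann e \<subseteq> ann ?x" using xE by (auto simp: E_def ann_def)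
    ultimately have "?x \<in> J \<or> adj ?y \<in> ann e" using maximal by blast
    moreover have "?y \<in> J" if "adj ?y \<in> ann e"
    proof (rule mem_if_adj_mult_mem)
      show "adj ?y * ?y \<in> J" using yE that unfolding E_def by blast
    qed
    ultimately show ?thesis by blast
  qed
  have near: "norm (id_blinfun - s *\<^sub>R T l) \<le> 1/4" if "s * l = - \<rho>" "\<bar>s\<bar> = 1" for s l
  proof (rule norm_blinfun_bound)
    fix x
    have "(id_blinfun - s *\<^sub>R T l) x = (1 / R) *\<^sub>R (R *\<^sub>R x - s *\<^sub>R (z * x) + (s * l) *\<^sub>R x)"
      using R(1) by (simp add: Tx blinfun.bilinear_simps algebra_simps)
    also have "\<dots> = (1 / R) *\<^sub>R (norm z *\<^sub>R x - s *\<^sub>R (z * x))"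
      unfolding that R(2)[symmetric] by (simp add: algebra_simps)
    also have "norm \<dots> \<le> (1 / R) * (norm z * norm x + norm z * norm x)"
    proof -
      have "norm (norm z *\<^sub>R x - s *\<^sub>R (z * x)) \<le> norm z * norm x + norm z * norm x"
      proof (rule order_trans[OF norm_triangle_ineq4 add_mono])
        show "norm (s *\<^sub>R (z * x)) \<le> norm z * norm x" using norm_mult_ineq[of z x] that by simp
      qed simp
      from mult_left_mono[OF this, of "1 / R"] R(1) show ?thesis by simp
    qed
    also have "\<dots> = (2 * norm z / R) * norm x" by simp
    also have "\<dots> \<le> 1/4 * norm x"
      using R by (intro mult_right_mono) (auto simp: divide_le_eq)
    finally show "norm ((id_blinfun - s *\<^sub>R T l) x) \<le> 1/4 * norm x" .
  qed simp
  \<comment> \<open>$U + T$ and $U - T$ are twice the positive and the negative part of $T$.\<close>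
  define A B where "A = {-\<rho>..\<rho>} \<inter> (\<lambda>l. (U l + T l) e) -` J"
    and "B = {-\<rho>..\<rho>} \<inter> (\<lambda>l. (U l - T l) e) -` J"
  have "U (- \<rho>) = T (- \<rho>)"
    unfolding U_def using near[of 1 "- \<rho>"] R by (intro mult_abs_near_id Ts Tn) auto
  then have "- \<rho> \<in> B" using R by (simp add: B_def zero_J)
  have "mult_abs (- T \<rho>) = - T \<rho>"
    using near[of "- 1" \<rho>] R Tn[of \<rho>] Ts selfadj_scaleR[OF Ts, of "- 1" \<rho>]
    by (intro mult_abs_near_id) auto
  then have "U \<rho> = - T \<rho>" by (simp add: U_def mult_abs_minus)
  then have "\<rho> \<in> A" using R by (simp add: A_def zero_J)
  have contT: "continuous_on {-\<rho>..\<rho>} T" unfolding T_def by (intro continuous_intros)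
  have contU: "continuous_on {-\<rho>..\<rho>} U"
    unfolding U_def by (rule continuous_on_compose2[OF continuous_on_mult_abs contT]) (use Ts Tn in auto)
  have "closed A" "closed B" unfolding A_def B_def
    by (intro continuous_closed_preimage continuous_intros contU contT closed_J closed_atLeastAtMost)+
  moreover have "{-\<rho>..\<rho>} \<subseteq> A \<union> B" unfolding A_def B_def using dich by blast
  moreover have "\<rho> \<in> A \<inter> {-\<rho>..\<rho>}" "- \<rho> \<in> B \<inter> {-\<rho>..\<rho>}"
    using \<open>\<rho> \<in> A\<close> \<open>- \<rho> \<in> B\<close> R by auto
  moreover have "connected {-\<rho>..\<rho>}" by simp
  ultimately obtain l where "l \<in> A \<inter> B \<inter> {-\<rho>..\<rho>}"
    unfolding connected_closed by blast
  then have "(U l + T l) e - (U l - T l) e \<in> J" unfolding A_def B_def by (blast intro: diff_J)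
  then have "T l e + T l e \<in> J" by (simp add: blinfun.bilinear_simps)
  then have "R *\<^sub>R (1/2) *\<^sub>R (T l e + T l e) \<in> J" by (intro scale_J)
  then have "z * e \<doteq> l *\<^sub>R e" using R(1) by (simp add: Tx eq_mod_def flip: scaleR_2)
  then show thesis by (rule that)
qed

text \<open>
  A nonzero projection of the quotient by $J$ that is minimal in the strong sense $pAp = \mathbb{C}p$.
\<close>

definition atom :: "'a \<Rightarrow> bool" where
  "atom p \<longleftrightarrow> adj p = p \<and> p \<notin> J \<and> p * p \<doteq> p \<and> (\<forall>y. \<exists>c. p * y * p \<doteq> c *\<^sub>C p)"

text \<open>
  \<open>eigenvalue_mod\<close> with $z = e$ makes a multiple $p$ of $e$ idempotent, and with $z = pyp$ it
  shows that $pyp$ is a multiple of $p$, for self-adjoint $y$ first.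
\<close>

lemma atom_if_maximal:
  assumes e: "adj e = e" "e \<notin> J"
    and maximal: "\<And>g. g \<notin> J \<Longrightarrow> ann e \<subseteq> ann g \<Longrightarrow> ann g \<subseteq> ann e"
  obtains p where "atom p" "ann p = ann e"
proof -
  have "b * e \<in> ann e" if "b \<in> ann e" for b
    using that mult_right_J by (simp add: ann_def)
  then obtain l :: real where l: "e * e \<doteq> l *\<^sub>R e"
    using eigenvalue_mod[OF e(1) e(1) maximal] by blast
  have "e * e \<notin> J" using mem_if_adj_mult_mem[of e] e by auto
  then have "l \<noteq> 0" using eq_mod_mem_iff[OF l] by (auto simp: zero_J)
  define p where "p = (1 / l) *\<^sub>R e"
  have p: "adj p = p" "ann p = ann e"
    using \<open>l \<noteq> 0\<close> by (simp_all add: p_def adj_scaleR e ann_scaleR)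
  have "p \<notin> J" using scale_J[of p l] e(2) \<open>l \<noteq> 0\<close> by (auto simp: p_def)
  have pp: "p * p \<doteq> p"
    using scale_J[OF l[unfolded eq_mod_def], of "1 / l * (1 / l)"] \<open>l \<noteq> 0\<close>
    by (simp add: eq_mod_def p_def scaleR_diff_right)
  have real_case: "\<exists>c::real. p * y * p \<doteq> c *\<^sub>R p" if y: "adj y = y" for y
  proof -
    have "b * (p * y * p) \<in> ann p" if "b \<in> ann p" for b
      using that mult_right_J[of "b * p" "y * p * p"] by (simp add: ann_def mult.assoc)
    moreover have "adj (p * y * p) = p * y * p" by (simp add: adj_mult p y mult.assoc)
    ultimately obtain c :: real where c: "p * y * p * p \<doteq> c *\<^sub>R p"
      using eigenvalue_mod[of p "p * y * p"] p maximal by metis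
    have "p * y * p \<doteq> p * y * p * p"
      using eq_mod_mult_left[OF eq_mod_sym[OF pp], of "p * y"] by (simp add: mult.assoc)
    then show ?thesis using eq_mod_trans[OF _ c] by blast
  qed
  have "\<exists>c. p * y * p \<doteq> c *\<^sub>C p" for y
  proof -
    define y1 y2 where "y1 = (1/2) *\<^sub>R (y + adj y)" and "y2 = - (\<i> *\<^sub>C (1/2) *\<^sub>R (y - adj y))"
    have y: "y = y1 + \<i> *\<^sub>C y2"
      by (simp add: y1_def y2_def scaleC_minus_right scaleC_i_i algebra_simps flip: scaleR_add_left)
    have "adj y1 = y1" by (simp add: y1_def adj_scaleR adj_add adj_adj add.commute)
    moreover have "adj y2 = y2"
      by (simp add: y2_def adj_minus adj_scaleC_i adj_scaleR adj_diff adj_adj flip: scaleC_minus_right scaleR_minus_right)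
    ultimately obtain c1 c2 :: real where "p * y1 * p \<doteq> c1 *\<^sub>R p" "p * y2 * p \<doteq> c2 *\<^sub>R p"
      using real_case by metis
    then have "p * y1 * p + \<i> *\<^sub>C (p * y2 * p) \<doteq> c1 *\<^sub>R p + \<i> *\<^sub>C c2 *\<^sub>R p"
      by (intro eq_mod_add eq_mod_scaleC)
    moreover have "p * y * p = p * y1 * p + \<i> *\<^sub>C (p * y2 * p)"
      by (subst y) (simp add: algebra_simps mult_scaleC_left mult_scaleC_right)
    moreover have "c1 *\<^sub>R p + \<i> *\<^sub>C c2 *\<^sub>R p = (c1 + \<i> * c2) *\<^sub>C p"
      by (simp add: scaleR_eq_scaleC scaleC_scaleC scaleC_add_left)
    ultimately show ?thesis by metis
  qed
  then have "atom p" using p \<open>p \<notin> J\<close> pp by (simp add: atom_def)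
  then show thesis using p that by blast
qed

text \<open>
  If $u = paq$ is not in $J$, then $u^*u = \nu q$ with $\nu \ne 0$ modulo $J$. For $w = pxq$ also
  $wu^* = \mu p$, and $\nu w = w u^* u = \mu u$.
\<close>

lemma atom_corner_one_dim:
  assumes p: "atom p" and q: "atom q"
  obtains v where "\<And>x. \<exists>c. p * x * q \<doteq> c *\<^sub>C v"
proof (cases "\<forall>x. p * x * q \<in> J")
  case True
  then show ?thesis using that[of 0] by (simp add: eq_mod_zero_iff)
next
  case False
  then obtain a where a: "p * a * q \<notin> J" by blast
  define u where "u = p * a * q"
  have "adj u * u = q * (adj a * p * p * a) * q"
    using p q by (simp add: u_def adj_mult atom_def mult.assoc)
  then obtain \<nu> where \<nu>: "adj u * u \<doteq> \<nu> *\<^sub>C q" using q by (metis atom_def)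
  have "adj u * u \<notin> J" using mem_if_adj_mult_mem[of u] a unfolding u_def by blast
  then have "\<nu> \<noteq> 0" using eq_mod_mem_iff[OF \<nu>] scaleR_eq_scaleC[of 0 q] by (auto simp: zero_J)
  have "\<exists>c. p * x * q \<doteq> c *\<^sub>C u" for x
  proof -
    define w where "w = p * x * q"
    have "w * adj u = p * (x * q * q * adj a) * p"
      using p q by (simp add: w_def u_def adj_mult atom_def mult.assoc)
    then obtain \<mu> where \<mu>: "w * adj u \<doteq> \<mu> *\<^sub>C p" using p by (metis atom_def)
    have wq: "w * q \<doteq> w" and pu: "p * u \<doteq> u"
      using eq_mod_mult_left[of "q * q" q "p * x"] eq_mod_mult_right[of "p * p" p "a * q"] p q
      by (simp_all add: w_def u_def atom_def mult.assoc)
    have "\<nu> *\<^sub>C w \<doteq> \<nu> *\<^sub>C (w * q)" by (intro eq_mod_scaleC eq_mod_sym[OF wq])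
    also have "\<dots> = w * (\<nu> *\<^sub>C q)" by (simp add: mult_scaleC_right)
    also have "\<dots> \<doteq> w * (adj u * u)" by (intro eq_mod_mult_left eq_mod_sym[OF \<nu>])
    also have "\<dots> = w * adj u * u" by (simp add: mult.assoc)
    also have "\<dots> \<doteq> (\<mu> *\<^sub>C p) * u" by (intro eq_mod_mult_right \<mu>)
    also have "\<dots> = \<mu> *\<^sub>C (p * u)" by (simp add: mult_scaleC_left)
    also have "\<dots> \<doteq> \<mu> *\<^sub>C u" by (intro eq_mod_scaleC pu)
    finally have "(1 / \<nu>) *\<^sub>C \<nu> *\<^sub>C w \<doteq> (1 / \<nu>) *\<^sub>C \<mu> *\<^sub>C u" by (rule eq_mod_scaleC)
    then show ?thesis using \<open>\<nu> \<noteq> 0\<close> by (auto simp: scaleC_scaleC scaleC_one w_def)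
  qed
  then show ?thesis using that by blast
qed

text \<open>
  The size of the coefficient $c$ is controlled by the norm of $w$, because $v$ has positive distance from $J$ unless it belongs
  to $J$.
\<close>

lemma bounded_mod_line:
  fixes D :: "'a \<Rightarrow> 'm::real_normed_vector"
  assumes D: "linear D" and K: "K \<ge> 0" "\<And>x. x \<in> J \<Longrightarrow> norm (D x) \<le> K * norm x"
  obtains L where "\<And>w c. w \<doteq> c *\<^sub>C v \<Longrightarrow> norm (D w) \<le> L * norm w"
proof (cases "v \<in> J")
  case True
  then have "w \<in> J" if "w \<doteq> c *\<^sub>C v" for w c
    using that eq_mod_mem_iff scaleC_mem by blast
  then show ?thesis using that[of K] K by blast
next
  case False
  interpret D: linear D by fact
  obtain \<delta> where \<delta>: "\<delta> > 0" "\<And>j. j \<in> J \<Longrightarrow> norm (v - j) \<ge> \<delta>"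
  proof -
    obtain \<delta> where "\<delta> > 0" "\<forall>j\<in>J. \<delta> \<le> dist j v"
      using closed_approachable[OF closed_J, of v] False by (meson not_le)
    then show ?thesis using that by (auto simp: dist_norm norm_minus_commute)
  qed
  define M where "M = norm (D v) + norm (D (\<i> *\<^sub>C v)) + K * norm v"
  have M: "M \<ge> 0" using K by (simp add: M_def)
  have "norm (D w) \<le> (M / \<delta> + K) * norm w" if w: "w \<doteq> c *\<^sub>C v" for w c
  proof -
    define j where "j = w - c *\<^sub>C v"
    have j: "j \<in> J" using w by (simp add: j_def eq_mod_def)
    have c: "cmod c * \<delta> \<le> norm w"
    proof (cases "c = 0")
      case c: False
      have "c * (- 1 / c) = - 1" using c by simp
      then have "c *\<^sub>C (v - (- 1 / c) *\<^sub>C j) = c *\<^sub>C v + j"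
        by (simp only: scaleC_diff_right scaleC_scaleC scaleC_minus_one diff_minus_eq_add)
      then have "w = c *\<^sub>C (v - (- 1 / c) *\<^sub>C j)" by (simp add: j_def)
      then have "norm w = cmod c * norm (v - (- 1 / c) *\<^sub>C j)" using norm_scaleC by metis
      then show ?thesis using \<delta>(2)[OF scaleC_mem[OF j]] by (simp add: mult_left_mono)
    qed simp
    have "c = complex_of_real (Re c) + complex_of_real (Im c) * \<i>"
      by (simp add: complex_eq mult.commute)
    then have "c *\<^sub>C v = Re c *\<^sub>R v + Im c *\<^sub>R (\<i> *\<^sub>C v)"
      by (metis scaleC_add_left scaleC_scaleC scaleR_eq_scaleC)
    then have "D w = Re c *\<^sub>R D v + Im c *\<^sub>R D (\<i> *\<^sub>C v) + D j"
      using D.add[of "c *\<^sub>C v" j] by (simp add: j_def D.add D.scale)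
    then have "norm (D w) \<le> \<bar>Re c\<bar> * norm (D v) + \<bar>Im c\<bar> * norm (D (\<i> *\<^sub>C v)) + norm (D j)"
      by (auto intro!: norm_triangle_le add_mono)
    also have "\<dots> \<le> cmod c * norm (D v) + cmod c * norm (D (\<i> *\<^sub>C v)) + K * (norm w + cmod c * norm v)"
    proof (intro add_mono mult_right_mono abs_Re_le_cmod abs_Im_le_cmod)
      have "norm j \<le> norm w + cmod c * norm v"
        using norm_triangle_ineq4[of w "c *\<^sub>C v"] by (simp add: j_def norm_scaleC)
      then show "norm (D j) \<le> K * (norm w + cmod c * norm v)"
        by (intro order_trans[OF K(2)[OF j]] mult_left_mono K(1))
    qed auto
    also have "\<dots> = cmod c * M + K * norm w" by (simp add: M_def algebra_simps)
    also have "\<dots> \<le> (norm w / \<delta>) * M + K * norm w"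
      using c \<delta>(1) M by (intro add_mono mult_right_mono) (auto simp: pos_le_divide_eq)
    finally show ?thesis by (simp add: algebra_simps)
  qed
  then show ?thesis by (rule that)
qed

lemma bounded_on_atom_corner:
  fixes D :: "'a \<Rightarrow> 'm::real_normed_vector"
  assumes D: "linear D" and K: "K \<ge> 0" "\<And>x. x \<in> J \<Longrightarrow> norm (D x) \<le> K * norm x"
    and pq: "atom p" "atom q"
  shows "\<exists>L. \<forall>x. norm (D (p * x * q)) \<le> L * norm x"
proof -
  obtain v where v: "\<And>x. \<exists>c. p * x * q \<doteq> c *\<^sub>C v"
    using atom_corner_one_dim[OF pq] by metis
  obtain L where L: "\<And>w c. w \<doteq> c *\<^sub>C v \<Longrightarrow> norm (D w) \<le> L * norm w"
    using bounded_mod_line[OF D K] by metis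
  have "norm (D (p * x * q)) \<le> (\<bar>L\<bar> * norm p * norm q) * norm x" for x
  proof -
    have "norm (D (p * x * q)) \<le> L * norm (p * x * q)" using v[of x] L by blast
    also have "\<dots> \<le> \<bar>L\<bar> * (norm p * norm x * norm q)"
      by (intro mult_mono order_trans[OF norm_mult_ineq] mult_right_mono norm_mult_ineq) auto
    finally show ?thesis by (simp add: mult_ac)
  qed
  then show ?thesis by blast
qed

end

text \<open>
  The triangular condition on $s$ and $r$ is what a strictly increasing sequence of annihilators
  produces ($s_n$ annihilates $r_{n+1}$ but not $r_n$), and through the involution also a strictly decreasing one.
\<close>

locale chain_ideal = closed_ideal +
  assumes chain: "\<nexists>s r. \<forall>n::nat. s n * r n \<notin> J \<and> (\<forall>m>n. s n * r m \<in> J)"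
begin

lemma maximal_annihilator:
  assumes "g \<in> S"
  obtains f where "f \<in> S" "\<And>h. h \<in> S \<Longrightarrow> ann f \<subseteq> ann h \<Longrightarrow> ann h \<subseteq> ann f"
proof -
  have "wf {(h, f). ann f \<subset> ann h}"
    unfolding wf_iff_no_infinite_down_chain
  proof
    assume "\<exists>f. \<forall>i. (f (Suc i), f i) \<in> {(h, f). ann f \<subset> ann h}"
    then obtain f where f: "\<And>i. ann (f i) \<subset> ann (f (Suc i))" by auto
    have "\<exists>b. \<forall>i. b i \<in> ann (f (Suc i)) - ann (f i)"
      by (intro choice allI psubset_imp_ex_mem f)
    then obtain b where b: "\<And>i. b i \<in> ann (f (Suc i)) - ann (f i)" by blast
    have "ann (f (Suc n)) \<subseteq> ann (f m)" if "n < m" for n m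
      using lift_Suc_mono_le[of "\<lambda>i. ann (f i)" "Suc n" m] f that by auto
    then have "\<forall>n. b n * f n \<notin> J \<and> (\<forall>m>n. b n * f m \<in> J)"
      using b by (force simp: ann_def)
    then show False using chain by blast
  qed
  from wfE_min[OF this assms] obtain f where "f \<in> S" "\<And>h. ann f \<subset> ann h \<Longrightarrow> h \<notin> S" by auto
  then show thesis using that by blast
qed

lemma minimal_annihilator:
  assumes "g \<in> S"
  obtains f where "f \<in> S" "\<And>h. h \<in> S \<Longrightarrow> ann h \<subseteq> ann f \<Longrightarrow> ann f \<subseteq> ann h"
proof -
  have "wf {(h, f). ann h \<subset> ann f}"
    unfolding wf_iff_no_infinite_down_chain
  proof
    assume "\<exists>f. \<forall>i. (f (Suc i), f i) \<in> {(h, f). ann h \<subset> ann f}"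
    then obtain f where f: "\<And>i. ann (f (Suc i)) \<subset> ann (f i)" by auto
    have "\<exists>b. \<forall>i. b i \<in> ann (f i) - ann (f (Suc i))"
      by (intro choice allI psubset_imp_ex_mem f)
    then obtain b where b: "\<And>i. b i \<in> ann (f i) - ann (f (Suc i))" by blast
    have anti: "ann (f m) \<subseteq> ann (f (Suc n))" if "n < m" for n m
      using lift_Suc_antimono_le[of "\<lambda>i. ann (f i)" "Suc n" m] f that by auto
    define s r where "s n = adj (f (Suc n))" and "r n = adj (b n)" for n
    have "s n * r m \<in> J \<longleftrightarrow> b m \<in> ann (f (Suc n))" for n m
      by (simp add: s_def r_def ann_def adj_mem_iff flip: adj_mult)
    then have "\<forall>n. s n * r n \<notin> J \<and> (\<forall>m>n. s n * r m \<in> J)" using b anti by blast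
    then show False using chain by blast
  qed
  from wfE_min[OF this assms] obtain f where "f \<in> S" "\<And>h. ann h \<subset> ann f \<Longrightarrow> h \<notin> S" by auto
  then show thesis using that by blast
qed

text \<open>
  Replacing an $f$ of maximal annihilator by $ff^*$ makes it self-adjoint and keeps the annihilator.
\<close>

lemma atom_below:
  assumes "r \<notin> J"
  obtains p where "atom p" "ann r \<subseteq> ann p"
proof -
  define S where "S = {f. f \<notin> J \<and> ann r \<subseteq> ann f}"
  have "r \<in> S" using assms by (simp add: S_def)
  then obtain f where fS: "f \<in> S"
    and max: "\<And>h. h \<in> S \<Longrightarrow> ann f \<subseteq> ann h \<Longrightarrow> ann h \<subseteq> ann f"
    by (rule maximal_annihilator) blast
  have f: "f \<notin> J" "ann r \<subseteq> ann f" using fS by (auto simp: S_def)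
  define e where "e = f * adj f"
  have ann_e: "ann e = ann f" by (simp add: e_def ann_mult_adj)
  have "adj e = e" by (simp add: e_def adj_mult adj_adj)
  moreover have "e \<notin> J" using f(1) mem_if_mult_adj_mem[of f] unfolding e_def by blast
  moreover have "ann g \<subseteq> ann e" if "g \<notin> J" "ann e \<subseteq> ann g" for g
    using max[of g] that f by (auto simp: ann_e S_def)
  ultimately obtain p where "atom p" "ann p = ann e" by (rule atom_if_maximal)
  then show thesis using that f by (simp add: ann_e)
qed

text \<open>
  Consider the projections $P$ modulo $J$ for which $x \mapsto D(qxP)$ is bounded. If one of them with minimal
  annihilator were not a unit modulo $J$, there would be an atom $p$ orthogonal to it, and $P + p$
  would be another one with a smaller annihilator. So $P$ is a unit modulo $J$, and $D(qx)$ differs from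
  $D(qxP)$ by a value of $D$ on $J$.
\<close>

lemma atom_left_bounded:
  fixes D :: "'a \<Rightarrow> 'm::real_normed_vector"
  assumes D: "linear D" and K: "K \<ge> 0" "\<And>x. x \<in> J \<Longrightarrow> norm (D x) \<le> K * norm x"
    and q: "atom q"
  shows "\<exists>L. \<forall>x. norm (D (q * x)) \<le> L * norm x"
proof -
  interpret D: linear D by fact
  define X where "X = {P. adj P = P \<and> P * P \<doteq> P \<and> (\<exists>L. \<forall>x. norm (D (q * x * P)) \<le> L * norm x)}"
  have "0 \<in> X" by (auto simp: X_def D.zero intro: exI[of _ 0])
  then obtain P where P: "P \<in> X"
    and min: "\<And>h. h \<in> X \<Longrightarrow> ann h \<subseteq> ann P \<Longrightarrow> ann P \<subseteq> ann h"
    by (rule minimal_annihilator) blast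
  have Padj: "adj P = P" and PP: "P * P \<doteq> P" using P by (auto simp: X_def)
  obtain L where L: "\<And>x. norm (D (q * x * P)) \<le> L * norm x" using P by (auto simp: X_def)
  have unit: "r - P * r \<in> J" for r
  proof (rule ccontr)
    assume "r - P * r \<notin> J"
    then obtain p where p: "atom p" "ann (r - P * r) \<subseteq> ann p" by (rule atom_below)
    have "P * (r - P * r) = - ((P * P - P) * r)" by (simp add: algebra_simps)
    then have "P \<in> ann (r - P * r)"
      using PP mult_right_J[of "P * P - P" r] by (simp add: ann_def eq_mod_def minus_J)
    then have Pp: "P * p \<in> J" using p by (auto simp: ann_def)
    then have pP: "p * P \<in> J"
      using adj_mem[of "P * p"] p Padj by (simp add: adj_mult atom_def)
    obtain L' where L': "\<And>x. norm (D (q * x * p)) \<le> L' * norm x"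
      using bounded_on_atom_corner[OF D K q p(1)] by blast
    have "norm (D (q * x * (P + p))) \<le> (L + L') * norm x" for x
      using norm_triangle_ineq[of "D (q * x * P)" "D (q * x * p)"] L[of x] L'[of x]
      by (simp add: distrib_left D.add distrib_right)
    moreover have "(P + p) * (P + p) \<doteq> P + p"
    proof -
      have "(P * P - P) + (p * p - p) + (P * p + p * P) \<in> J"
        using PP p Pp pP by (intro add_J) (auto simp: eq_mod_def atom_def)
      then show ?thesis by (simp add: eq_mod_def algebra_simps)
    qed
    ultimately have "P + p \<in> X" using Padj p by (auto simp: X_def adj_add atom_def)
    moreover have "b * P \<in> J" if "b * (P + p) \<in> J" for b
    proof -
      have "b * (P + p) * P - b * (p * P) \<in> J" by (intro diff_J mult_right_J that mult_left_J pP)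
      then have "b * (P * P) \<in> J" by (simp add: algebra_simps)
      then show ?thesis using eq_mod_mem_iff[OF eq_mod_mult_left[OF PP]] by blast
    qed
    ultimately have "ann P \<subseteq> ann (P + p)" using min by (auto simp: ann_def)
    then have "p * (P + p) \<in> J" using pP by (auto simp: ann_def)
    then have "p * p \<in> J" using diff_J[OF _ pP] by (force simp: distrib_left)
    then have "p \<in> J" using p eq_mod_mem_iff by (auto simp: atom_def)
    then show False using p by (simp add: atom_def)
  qed
  have "norm (D (q * x)) \<le> (L + K * norm q * (1 + norm P)) * norm x" for x
  proof -
    have "x - x * P = adj (adj x - P * adj x)" by (simp add: adj_diff adj_mult adj_adj Padj)
    then have "x - x * P \<in> J" using adj_mem[OF unit] by metis
    then have j: "q * (x - x * P) \<in> J" by (rule mult_left_J)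
    have "norm (x - x * P) \<le> (1 + norm P) * norm x"
      using norm_triangle_ineq4[of x "x * P"] norm_mult_ineq[of x P] by (simp add: algebra_simps)
    then have "norm (q * (x - x * P)) \<le> norm q * ((1 + norm P) * norm x)"
      by (meson norm_mult_ineq order_trans mult_left_mono norm_ge_zero)
    then have "norm (D (q * (x - x * P))) \<le> K * (norm q * ((1 + norm P) * norm x))"
      by (intro order_trans[OF K(2)[OF j]] mult_left_mono K(1))
    moreover have "D (q * x) = D (q * x * P) + D (q * (x - x * P))"
      by (simp add: right_diff_distrib mult.assoc flip: D.add)
    ultimately show ?thesis
      using norm_triangle_ineq[of "D (q * x * P)" "D (q * (x - x * P))"] L[of x]
      by (simp add: algebra_simps)
  qed
  then show ?thesis by blast
qed

end

section \<open>Automatic continuity\<close>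

text \<open>
  The situation of a derivation with $D(ab) = C(a,b) + B(a,b)$, where $C$ and $B$ are continuous in
  one argument only. The last assumption holds when
  $B(a,b) = G(a)H(b)$ with $G$ multiplicative on the range of $H$, since then $B(ba,\cdot) = G(b)B(a,\cdot)$.
\<close>

locale separated_product =
  fixes D :: "'a::cstar_algebra \<Rightarrow> 'm::real_normed_vector"
    and B C :: "'a \<Rightarrow> 'a \<Rightarrow> 'm"
  assumes linear_D: "linear D"
    and product: "\<And>a b. D (a * b) = C a b + B a b"
    and bounded_C: "\<And>a. bounded_linear (C a)"
    and bounded_B: "\<And>b. bounded_linear (\<lambda>a. B a b)"
    and left_ideal: "\<And>a b. bounded_linear (B a) \<Longrightarrow> bounded_linear (B (b * a))"
begin

sublocale D: linear D by (rule linear_D)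

definition J :: "'a set" where
  "J = {a. \<exists>K. \<forall>x. norm (D (a * x)) \<le> K * norm x}"

lemma J_iff: "a \<in> J \<longleftrightarrow> bounded_linear (B a)"
proof -
  have B: "B a = (\<lambda>x. D (a * x) - C a x)" by (simp add: product)
  have lin: "linear (\<lambda>x. D (a * x))"
    by (rule linearI) (simp_all add: distrib_left D.add D.scale)
  show ?thesis
  proof
    assume "a \<in> J"
    then obtain K where "\<And>x. norm (D (a * x)) \<le> norm x * K" by (auto simp: J_def mult.commute)
    then have "bounded_linear (\<lambda>x. D (a * x))"
      by (rule bounded_linear_intro[OF linear_add[OF lin] linear_scale[OF lin]])
    then show "bounded_linear (B a)"
      unfolding B by (intro bounded_linear_sub bounded_C)
  next
    assume "bounded_linear (B a)"
    then have "bounded_linear (\<lambda>x. C a x + B a x)"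
      by (intro bounded_linear_add bounded_C)
    then have "bounded_linear (\<lambda>x. D (a * x))" by (simp add: product)
    then obtain K where "\<forall>x. norm (D (a * x)) \<le> norm x * K"
      using bounded_linear.bounded by blast
    then show "a \<in> J" unfolding J_def by (auto simp: mult.commute)
  qed
qed

text \<open>
  If $a_n \to l$, the operators $B(a_n,\cdot)$ converge pointwise to $B(l,\cdot)$, by continuity in the first argument.
\<close>

lemma J_closed: "closed J"
  unfolding closed_sequential_limits
proof (intro allI impI)
  fix a l assume a: "(\<forall>n. a n \<in> J) \<and> a \<longlonglongrightarrow> l"
  define T where "T n = Blinfun (B (a n))" for n
  have T: "T n x = B (a n) x" for n x
    using a J_iff by (simp add: T_def bounded_linear_Blinfun_apply)
  have lim: "(\<lambda>n. B (a n) x) \<longlonglongrightarrow> B l x" for x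
    using a by (intro bounded_linear.tendsto[OF bounded_B]) auto
  have "\<exists>M. \<forall>n. norm (T n x) \<le> M" for x
    using convergent_imp_Bseq[OF convergentI[OF lim[of x]]] by (auto simp: T Bseq_def)
  then obtain K where K: "\<And>n. norm (T n) \<le> K" using uniform_boundedness[of T] by blast
  have le: "norm (B l x) \<le> norm x * K" for x
  proof (rule tendsto_upperbound[OF tendsto_norm[OF lim]])
    have "norm (B (a n) x) \<le> norm x * K" for n
      using order_trans[OF norm_blinfun mult_right_mono[OF K norm_ge_zero]]
      by (metis T mult.commute)
    then show "\<forall>\<^sub>F n in sequentially. norm (B (a n) x) \<le> norm x * K" by simp
  qed simp
  have lin: "linear (B l)"
  proof -
    interpret Cl: bounded_linear "C l" by (rule bounded_C)
    have B: "B l = (\<lambda>x. D (l * x) - C l x)" by (simp add: product)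
    show ?thesis unfolding B
      by (rule linearI) (simp_all add: distrib_left D.add D.scale Cl.add Cl.scale algebra_simps)
  qed
  have "bounded_linear (B l)"
    by (rule bounded_linear_intro[OF linear_add[OF lin] linear_scale[OF lin] le])
  then show "l \<in> J" by (simp add: J_iff)
qed

sublocale closed_ideal J
proof
  show "subspace J"
  proof (rule subspaceI)
    show "0 \<in> J" by (auto simp: J_def D.zero intro: exI[of _ 0])
  next
    fix a b assume "a \<in> J" "b \<in> J"
    then obtain K L where "\<And>x. norm (D (a * x)) \<le> K * norm x" "\<And>x. norm (D (b * x)) \<le> L * norm x"
      by (auto simp: J_def)
    then have "norm (D ((a + b) * x)) \<le> (K + L) * norm x" for x
      unfolding distrib_right D.add by (intro norm_triangle_le add_mono)
    then show "a + b \<in> J" by (auto simp: J_def)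
  next
    fix c a assume "a \<in> J"
    then obtain K where "\<And>x. norm (D (a * x)) \<le> K * norm x" by (auto simp: J_def)
    then have "norm (D ((c *\<^sub>R a) * x)) \<le> (\<bar>c\<bar> * K) * norm x" for x
      by (simp add: D.scale mult.assoc mult_left_mono)
    then show "c *\<^sub>R a \<in> J" unfolding J_def by blast
  qed
  show "closed J" by (rule J_closed)
  show "b * a \<in> J" if "a \<in> J" for a b using that left_ideal by (simp add: J_iff)
  show "a * b \<in> J" if a: "a \<in> J" for a b
  proof -
    obtain K where K: "\<And>x. norm (D (a * x)) \<le> K * norm x" using a by (auto simp: J_def)
    have "norm (D (a * b * x)) \<le> (\<bar>K\<bar> * norm b) * norm x" for x
    proof -
      have "norm (D (a * b * x)) \<le> K * norm (b * x)" using K[of "b * x"] by (simp add: mult.assoc)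
      also have "\<dots> \<le> \<bar>K\<bar> * (norm b * norm x)" by (intro mult_mono norm_mult_ineq) auto
      finally show ?thesis by (simp add: mult.assoc)
    qed
    then show ?thesis by (auto simp: J_def)
  qed
qed

lemma bounded_on_J:
  obtains K where "K \<ge> 0" "\<And>x. x \<in> J \<Longrightarrow> norm (D x) \<le> K * norm x"
  using bounded_on_ideal[OF linear_D] unfolding J_def by blast

lemma unbounded_direction:
  assumes "s * r \<notin> J" "\<delta> > 0"
  obtains t where "norm (r * t) \<le> \<delta>" "norm (D (s * r * t)) \<ge> L"
proof -
  define \<eta> where "\<eta> = \<delta> / (norm r + 1)"
  have \<eta>: "\<eta> > 0" using assms(2) by (simp add: \<eta>_def add_nonneg_pos)
  obtain x where x: "norm (D (s * r * x)) > \<bar>L\<bar> / \<eta> * norm x"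
    using assms(1) unfolding J_def mem_Collect_eq by (meson not_le)
  then have "x \<noteq> 0" by (auto simp: D.zero)
  define t where "t = (\<eta> / norm x) *\<^sub>R x"
  have nt: "norm t = \<eta>" using \<eta> \<open>x \<noteq> 0\<close> by (simp add: t_def)
  have "norm (r * t) \<le> norm r * \<eta>" using norm_mult_ineq[of r t] by (simp add: nt)
  also have "\<dots> \<le> (norm r + 1) * \<eta>" using \<eta> by (intro mult_right_mono) auto
  also have "\<dots> = \<delta>" by (simp add: \<eta>_def add_nonneg_eq_0_iff)
  finally have 1: "norm (r * t) \<le> \<delta>" .
  have "\<bar>L\<bar> = \<eta> / norm x * (\<bar>L\<bar> / \<eta> * norm x)" using \<eta> \<open>x \<noteq> 0\<close> by simp
  also have "\<dots> \<le> \<eta> / norm x * norm (D (s * r * x))"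
    using x \<eta> by (intro mult_left_mono) auto
  also have "\<dots> = norm (D (s * r * t))" using \<eta> by (simp add: t_def D.scale)
  finally show thesis using 1 that[of t] by auto
qed

text \<open>
  Partial sums $c_n$ of $w = \sum_n r_n t_n$ are chosen such that $D(s_n r_n t_n)$ exceeds $D(s_n c_n)$ by a
  margin $M_n$; this is possible because $s_n r_n$ is not in $J$. The tail $s_n(w - c_{n+1})$ is in $J$,
  where $D$ is bounded. So $D(s_n w)$ would be larger than the bound that comes from $C(s_n,\cdot)$, which is known
  when $t_n$ is chosen, and $B(\cdot,w)$, which is not, but grows only linearly in $s_n$.
\<close>

lemma gliding_hump: "\<nexists>s r. \<forall>n::nat. s n * r n \<notin> J \<and> (\<forall>m>n. s n * r m \<in> J)"
proof (intro notI, elim exE)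
  fix s r :: "nat \<Rightarrow> 'a" 
  assume sr: "\<forall>n. s n * r n \<notin> J \<and> (\<forall>m>n. s n * r m \<in> J)"
  obtain K where K: "K \<ge> 0" "\<And>x. x \<in> J \<Longrightarrow> norm (D x) \<le> K * norm x"
    using bounded_on_J by metis
  have "\<exists>k. \<forall>a x. norm (C a x) \<le> norm x * k a"
    using bounded_linear.bounded[OF bounded_C] by metis
  then obtain k where k: "\<And>a x. norm (C a x) \<le> norm x * k a" by blast
  \<comment> \<open>The summands pay for the tail, for $C(s_n, w)$ and, for all large $n$, for $B(s_n, w)$.\<close>
  define M where "M n = 2 * K * norm (s n) + 2 * \<bar>k (s n)\<bar> + real n * norm (s n)" for n
  have "\<exists>c. \<forall>n. (n = 0 \<longrightarrow> c n = 0) \<and> (\<exists>t. c (Suc n) = c n + r n * t \<and> norm (r n * t) \<le> 1 * (1/2) ^ n \<and>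
      norm (D (s n * r n * t)) \<ge> norm (D (s n * c n)) + M n)"
  proof (rule dependent_nat_choice)
    fix c :: 'a and n
    have "s n * r n \<notin> J" "(0::real) < (1/2) ^ n" using sr by simp_all
    from unbounded_direction[OF this, of "norm (D (s n * c)) + M n"]
    obtain t where "norm (r n * t) \<le> (1/2) ^ n" "norm (D (s n * r n * t)) \<ge> norm (D (s n * c)) + M n"
      by metis
    then show "\<exists>y. (Suc n = 0 \<longrightarrow> y = 0) \<and> (\<exists>t. y = c + r n * t \<and> norm (r n * t) \<le> 1 * (1/2) ^ n \<and>
        norm (D (s n * r n * t)) \<ge> norm (D (s n * c)) + M n)" by auto
  qed simp
  then obtain c where c0: "c 0 = 0" and "\<forall>n. \<exists>t. c (Suc n) = c n + r n * t \<and> norm (r n * t) \<le> 1 * (1/2) ^ n \<and>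
      norm (D (s n * r n * t)) \<ge> norm (D (s n * c n)) + M n" by blast
  then obtain t where ct: "\<And>n. c (Suc n) = c n + r n * t n"
    and small: "\<And>n. norm (r n * t n) \<le> 1 * (1/2) ^ n"
    and large: "\<And>n. norm (D (s n * r n * t n)) \<ge> norm (D (s n * c n)) + M n" by metis
  have step: "norm (c (Suc n) - c n) \<le> 1 * (1/2) ^ n" for n
    using small[of n] by (simp add: ct)
  obtain w where w: "c \<longlonglongrightarrow> w" "\<And>n. norm (w - c n) \<le> 1 * (1/2) ^ n / (1 - 1/2)"
    using geometric_steps_converge[OF step] by auto
  obtain kw where kw: "\<And>a. norm (B a w) \<le> norm a * kw"
    using bounded_linear.bounded[OF bounded_B[of w]] by blast
  have near: "norm (w - c n) \<le> 2" for n
    using w(2)[of n] power_le_one[of "1/2::real" n] by simp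
  have tail: "s n * (w - c (Suc n)) \<in> J" for n
  proof -
    have partial: "s n * (c (i + Suc n) - c (Suc n)) \<in> J" for i
    proof (induction i)
      case (Suc i)
      have "s n * (c (Suc i + Suc n) - c (Suc n))
          = s n * (c (i + Suc n) - c (Suc n)) + s n * r (i + Suc n) * t (i + Suc n)"
        using ct[of "i + Suc n"] by (simp add: algebra_simps)
      moreover have "s n * r (i + Suc n) * t (i + Suc n) \<in> J"
        using sr mult_right_J[of "s n * r (i + Suc n)"] by simp
      ultimately show ?case using add_J[OF Suc.IH] by simp
    qed (simp add: zero_J)
    have "(\<lambda>i. s n * (c (i + Suc n) - c (Suc n))) \<longlonglongrightarrow> s n * (w - c (Suc n))"
      by (intro tendsto_intros LIMSEQ_ignore_initial_segment w)
    from closed_sequentially[OF closed_J partial this] show ?thesis .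
  qed
  have "real n \<le> kw" for n
  proof -
    have "s n * w = (s n * c n + s n * r n * t n) + s n * (w - c (Suc n))"
      by (simp add: ct algebra_simps)
    then have "D (s n * r n * t n) = D (s n * w) - D (s n * c n) - D (s n * (w - c (Suc n)))"
      by (simp add: D.add)
    then have "norm (D (s n * r n * t n))
        \<le> norm (D (s n * w)) + norm (D (s n * c n)) + norm (D (s n * (w - c (Suc n))))"
      by (metis norm_triangle_ineq4 norm_triangle_le_diff add_mono order_refl)
    moreover have "norm (D (s n * (w - c (Suc n)))) \<le> K * (norm (s n) * 2)"
    proof (intro order_trans[OF K(2)[OF tail]] mult_left_mono K(1) order_trans[OF norm_mult_ineq])
      show "norm (w - c (Suc n)) \<le> 2" by (rule near)
    qed simp
    moreover have "norm (D (s n * w)) \<le> 2 * \<bar>k (s n)\<bar> + norm (s n) * kw"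
    proof -
      have "norm (C (s n) w) \<le> norm w * \<bar>k (s n)\<bar>"
        by (intro order_trans[OF k] mult_left_mono) auto
      also have "\<dots> \<le> 2 * \<bar>k (s n)\<bar>"
        using near[of 0] by (intro mult_right_mono) (auto simp: c0)
      finally show ?thesis unfolding product by (intro norm_triangle_le add_mono kw)
    qed
    ultimately have "real n * norm (s n) \<le> kw * norm (s n)"
      using large[of n] by (simp add: M_def algebra_simps)
    moreover have "s n \<noteq> 0" using sr zero_J by (metis mult_zero_left)
    ultimately show ?thesis by simp
  qed
  then show False using reals_Archimedean2[of kw] by (meson not_le)
qed

sublocale chain_ideal J
  by unfold_locales (rule gliding_hump)

lemma J_eq_UNIV: "J = UNIV"
proof (rule ccontr)
  assume "J \<noteq> UNIV"
  then obtain r where "r \<notin> J" by blast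
  then obtain q where q: "atom q" by (rule atom_below)
  obtain K where K: "K \<ge> 0" "\<And>x. x \<in> J \<Longrightarrow> norm (D x) \<le> K * norm x"
    using bounded_on_J by metis
  have "q \<in> J" using atom_left_bounded[OF linear_D K q] by (simp add: J_def)
  then show False using q by (simp add: atom_def)
qed

lemma bounded_linear_D: "bounded_linear D"
proof -
  obtain K where K: "\<And>x. norm (D x) \<le> K * norm x"
    using bounded_on_J by (auto simp: J_eq_UNIV)
  show ?thesis
    by (intro bounded_linear_intro[of _ K]) (simp_all add: D.add D.scale K mult.commute)
qed

end

section \<open>Generalized derivations\<close>

lemma clinear_imp_linear:
  assumes "clinear f" shows "linear f"
proof -
  interpret Vector_Spaces.linear scaleC scaleC f by fact
  show ?thesis by (rule linearI) (simp_all add: add scale scaleR_eq_scaleC)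
qed

theorem theorem2p1:
  fixes lact :: "'b :: complex_banach_algebra \<Rightarrow> 'm :: complex_banach \<Rightarrow> 'm"
    and ract :: "'m \<Rightarrow> 'b \<Rightarrow> 'm"
    and D\<^sub>1 E H :: "'a :: cstar_algebra \<Rightarrow> 'm"
    and F G :: "'a \<Rightarrow> 'b"
  assumes "banach_bimodule lact ract"
    and "EFGH_derivation lact ract E F G H D\<^sub>1"
    and "clinear E" and "clinear H"
    and "isCont F 0" and "isCont G 0"
    and "(\<forall>a b c. lact (G (a * b) - G a * G b) (H c) = 0) \<or>
         (\<forall>a b c. ract (E c) (F (a * b) - F a * F b) = 0)"
  shows "continuous_on UNIV D\<^sub>1"
proof -
  interpret banach_bimodule lact ract by fact
  interpret L: bounded_bilinear lact by (rule bounded_bilinear_lact)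
  interpret R: bounded_bilinear ract by (rule bounded_bilinear_ract)
  have prod: "D\<^sub>1 (a * b) = ract (E a) (F b) + lact (G a) (H b)" for a b
    using assms(2) by (simp add: EFGH_derivation_def)
  have linD: "linear D\<^sub>1"
    using assms(2) by (intro clinear_imp_linear) (simp add: EFGH_derivation_def)
  interpret D: linear D\<^sub>1 by (rule linD)
  interpret E: linear E by (intro clinear_imp_linear assms)
  interpret H: linear H by (intro clinear_imp_linear assms)
  have bE: "bounded_linear (\<lambda>b. ract (E a) (F b))" for a
  proof (rule linear_isCont_zero_bounded)
    have eq: "ract (E a) (F b) = D\<^sub>1 (a * b) - lact (G a) (H b)" for b by (simp add: prod)
    show "linear (\<lambda>b. ract (E a) (F b))"
      unfolding eq by (rule linearI)
        (simp_all add: distrib_left D.add D.scale H.add H.scale L.add_right L.scaleR_right algebra_simps)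
    show "isCont (\<lambda>b. ract (E a) (F b)) 0"
      using assms(5) by (intro bounded_linear.isCont[OF R.bounded_linear_right])
  qed
  have bH: "bounded_linear (\<lambda>a. lact (G a) (H b))" for b
  proof (rule linear_isCont_zero_bounded)
    have eq: "lact (G a) (H b) = D\<^sub>1 (a * b) - ract (E a) (F b)" for a by (simp add: prod)
    show "linear (\<lambda>a. lact (G a) (H b))"
      unfolding eq by (rule linearI)
        (simp_all add: distrib_right D.add D.scale E.add E.scale R.add_left R.scaleR_left algebra_simps)
    show "isCont (\<lambda>a. lact (G a) (H b)) 0"
      using assms(6) by (intro bounded_linear.isCont[OF L.bounded_linear_left])
  qed
  from assms(7) have "bounded_linear D\<^sub>1"
  proof
    assume G: "\<forall>a b c. lact (G (a * b) - G a * G b) (H c) = 0"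
    have G: "lact (G (a * b)) (H c) = lact (G a) (lact (G b) (H c))" for a b c
      using G by (simp add: L.diff_left lact_mult)
    interpret separated_product D\<^sub>1 "\<lambda>a b. lact (G a) (H b)" "\<lambda>a b. ract (E a) (F b)"
    proof (rule separated_product.intro)
      show "bounded_linear (\<lambda>c. lact (G (b * a)) (H c))"
        if "bounded_linear (\<lambda>c. lact (G a) (H c))" for a b
        unfolding G by (rule bounded_linear_compose[OF L.bounded_linear_right that])
    qed (rule linD prod bE bH)+
    show ?thesis by (rule bounded_linear_D)
  next
    assume F: "\<forall>a b c. ract (E c) (F (a * b) - F a * F b) = 0"
    have F: "ract (E c) (F (a * b)) = ract (ract (E c) (F a)) (F b)" for a b c
      using F by (simp add: R.diff_right ract_mult)
    note adj = bounded_linear_adj[where 'a='a]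
    have "bounded_linear (\<lambda>x. D\<^sub>1 (adj x))"
    proof -
      \<comment> \<open>The involution reverses products, so $B$ and $C$ change places.\<close>
      interpret separated_product "\<lambda>x. D\<^sub>1 (adj x)" "\<lambda>a b. ract (E (adj b)) (F (adj a))"
        "\<lambda>a b. lact (G (adj b)) (H (adj a))"
      proof (rule separated_product.intro)
        show "linear (\<lambda>x. D\<^sub>1 (adj x))"
          using linear_compose[OF bounded_linear.linear[OF adj] linD] by (simp add: o_def)
        show "D\<^sub>1 (adj (a * b)) = lact (G (adj b)) (H (adj a)) + ract (E (adj b)) (F (adj a))" for a b
          by (simp add: adj_mult prod)
        show "bounded_linear (\<lambda>b. lact (G (adj b)) (H (adj a)))" for a
          by (rule bounded_linear_compose[OF bH adj])
        show "bounded_linear (\<lambda>a. ract (E (adj b)) (F (adj a)))" for b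
          by (rule bounded_linear_compose[OF bE adj])
        show "bounded_linear (\<lambda>c. ract (E (adj c)) (F (adj (b * a))))"
          if "bounded_linear (\<lambda>c. ract (E (adj c)) (F (adj a)))" for a b
          unfolding adj_mult F by (rule bounded_linear_compose[OF R.bounded_linear_left that])
      qed
      show ?thesis by (rule bounded_linear_D)
    qed
    from bounded_linear_compose[OF this adj] show ?thesis by (simp add: adj_adj)
  qed
  then show ?thesis by (intro linear_continuous_on)
qed

end
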